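(* Let $Y_i\sim \mathrm{Poi}(\theta_i)$ independently for $i=1,\dots,n$, where each $\theta_i$ is generated from the two-group model $\theta_i \overset{iid}{\sim} (1-p)\,Ga(\alpha,\beta)+p\,Ga(\alpha,\beta+\delta)$, with latent indicators $\nu_i$. Suppose we test $H_{0i}:\nu_i=0$ against $H_{1i}:\nu_i=1$ simultaneously for $i=1,\dots,n$ using the rule: reject $H_{0i}$ if $1-\mathbb{E}(\kappa_i\mid Y_i,\tau)>\frac{\delta}{2(\delta+1)}$, where the posterior mean is computed under the one-group prior with parameters $\alpha$, $\tau$, $a$, $L$, $K$ described in the context. Assume that $L$ satisfies conditions (A1) and (A2) given in the context, that $a>1$, that $p,\beta,\delta$ (and $\alpha$) satisfy Assumption 1 given in the context, and that $\tau\to 0$ as $n\to\infty$. Let $R_{\mathrm{OG}}$ be the Bayes risk (with respect to additive $0$-$1$ loss) of this rule and $R^{\mathrm{BO}}_{\mathrm{Opt}}$ the Bayes risk of the optimal multiple testing rule (the Bayes Oracle). Then $$1\le \liminf_{n\to\infty}\frac{R_{\mathrm{OG}}}{R^{\mathrm{BO}}_{\mathrm{Opt}}}\le \limsup_{n\to\infty}\frac{R_{\mathrm{OG}}}{R^{\mathrm{BO}}_{\mathrm{Opt}}}\le (\delta+1)^{\alpha}\,\mathbb{P}\Big(Y\le 2a+\alpha-\frac{2(a+\alpha)}{\delta+2}\Big),$$ where $Y\sim NB\big(\alpha,\frac{1}{\delta+1}\big)$.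
   Context: Distributions: $\mathrm{Poi}(\theta)$ is the Poisson distribution with mean $\theta$. $Ga(\alpha_1,\alpha_2)$ is the Gamma distribution with shape $\alpha_1>0$ and scale $\alpha_2>0$, density $\frac{1}{\Gamma(\alpha_1)\alpha_2^{\alpha_1}}x^{\alpha_1-1}e^{-x/\alpha_2}$, $x>0$. $NB(\alpha,q)$ is the negative binomial distribution with size $\alpha>0$ and success probability $q$, with mass function $\binom{y+\alpha-1}{y}(1-q)^y q^{\alpha}$, $y=0,1,2,\dots$. Two-group (true) model: $\nu_1,\dots,\nu_n$ are independent with $P(\nu_i=1)=p=1-P(\nu_i=0)$; given $\nu_i=0$, $\theta_i\sim Ga(\alpha,\beta)$; given $\nu_i=1$, $\theta_i\sim Ga(\alpha,\beta+\delta)$ (independently over $i$); given $\theta_i$, $Y_i\sim \mathrm{Poi}(\theta_i)$ independently. Hence marginally $Y_i\sim NB(\alpha,\frac1{\beta+1})$ under $H_{0i}$ and $Y_i\sim NB(\alpha,\frac{1}{\beta+\delta+1})$ under $H_{1i}$. Bayes risk: for a multiple testing rule with type I error $t_{1i}=P_{H_{0i}}(H_{0i}\text{ rejected})$ and type II error $t_{2i}=P_{H_{1i}}(H_{0i}\text{ accepted})$ for the $i$-th test, the Bayes risk under additive $0$-$1$ loss is $R=\sum_{i=1}^n[(1-p)t_{1i}+p\,t_{2i}]$. The Bayes Oracle is the rule minimizing $R$; it rejects $H_{0i}$ iff $f_{H_{1i}}(Y_i)/f_{H_{0i}}(Y_i)>(1-p)/p$, where $f_{H_{0i}},f_{H_{1i}}$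 are the marginal mass functions of $Y_i$ under $H_{0i},H_{1i}$. Assumption 1: as $n\to\infty$, $p=p_n\to 0$; $\alpha$ and $\delta$ are fixed and bounded away from both $0$ and infinity; and $\beta=\beta_n\propto p^{C_1}$ for some constant $C_1>1$. One-group prior (used only to define the rule): given $\tau>0$ and $\lambda_i$, $\theta_i\sim Ga(\alpha,\lambda_i^2\tau^2)$ independently, and $\lambda_i^2$ has density $\pi_1(\lambda_i^2)=K(\lambda_i^2)^{-a-1}L(\lambda_i^2)$ on $(0,\infty)$, where $K>0$ is the normalizing constant, $a>0$ is fixed, and $L:(0,\infty)\to(0,\infty)$ is a measurable non-constant slowly varying function (i.e. $L(cx)/L(x)\to1$ as $x\to\infty$ for every $c>0$). Put $\kappa_i=1/(1+\lambda_i^2\tau^2)$. The posterior density of $\kappa_i$ is $\pi(\kappa_i\mid Y_i,\tau)\propto \kappa_i^{a+\alpha-1}(1-\kappa_i)^{Y_i-a-1}L\big(\frac{1}{\tau^2}(\frac1{\kappa_i}-1)\big)$, $0<\kappa_i<1$, and $\mathbb{E}(\kappa_i\mid Y_i,\tau)$ is its mean. (A1) There exist $c_0>0$ and $t_0>0$ (depending on $L$ and $c_0$) with $L(t)\ge c_0$ for all $t\ge t_0$, and $\lim_{t\to\infty}L(t)\in(0,\infty)$. (A2) There exists $M\in(0,\infty)$ with $\sup_{t\in(0,\infty)}L(t)\le M$. *)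

theory Defs
  imports "HOL-Probability.Probability"
begin

section \<open>Distributions\<close>

definition gamma_density :: "real \<Rightarrow> real \<Rightarrow> real \<Rightarrow> real" where
  "gamma_density k s x =
     (if 0 < x then x powr (k - 1) * exp (- x / s) / (Gamma k * s powr k) else 0)"

text \<open>The library's \<^const>\<open>neg_binomial_pmf\<close> only allows a size in \<^typ>\<open>nat\<close>.\<close>

definition nb_mass :: "real \<Rightarrow> real \<Rightarrow> nat \<Rightarrow> real" where
  "nb_mass k q y = ((real y + k - 1) gchoose y) * (1 - q) ^ y * q powr k"

definition nb_pmf :: "real \<Rightarrow> real \<Rightarrow> nat pmf" where
  "nb_pmf k q = embed_pmf (nb_mass k q)"

lemma nb_mass_pochhammer: "nb_mass k q y = pochhammer k y / fact y * (1 - q) ^ y * q powr k"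
  by (simp add: nb_mass_def gbinomial_pochhammer')

lemma nb_mass_nonneg:
  assumes "0 < k" "0 < q" "q \<le> 1"
  shows "0 \<le> nb_mass k q y"
  using assms by (simp add: nb_mass_pochhammer pochhammer_nonneg)

lemma nb_mass_sums:
  assumes "0 < q" "q \<le> 1"
  shows "nb_mass k q sums 1"
proof -
  have "(\<lambda>n. ((-k) gchoose n) * (q - 1) ^ n) sums (1 + (q - 1)) powr (-k)"
    using assms by (intro gen_binomial_real) auto
  then have "(\<lambda>n. ((-k) gchoose n) * (q - 1) ^ n * q powr k) sums (q powr (-k) * q powr k)"
    by (intro sums_mult2) simp
  moreover have "((-k) gchoose n) * (q - 1) ^ n * q powr k = nb_mass k q n" for n
  proof -
    have "(q - 1) ^ n = (-1) ^ n * (1 - q) ^ n"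
      by (simp flip: power_mult_distrib)
    then show ?thesis
      by (simp add: nb_mass_def gbinomial_minus add.commute flip: power_mult_distrib)
  qed
  moreover have "q powr (-k) * q powr k = 1"
    using assms by (simp flip: powr_add)
  ultimately show ?thesis by simp
qed

lemma pmf_nb_pmf:
  assumes "0 < k" "0 < q" "q \<le> 1"
  shows "pmf (nb_pmf k q) y = nb_mass k q y"
  unfolding nb_pmf_def
proof (rule pmf_embed_pmf)
  have "(\<integral>\<^sup>+y. ennreal (nb_mass k q y) \<partial>count_space UNIV) = (\<Sum>y. ennreal (nb_mass k q y))"
    by (rule nn_integral_count_space_nat)
  also have "\<dots> = 1"
    using suminf_ennreal_eq[OF nb_mass_nonneg[OF assms] nb_mass_sums[OF assms(2,3)]] by simp
  finally show "(\<integral>\<^sup>+y. ennreal (nb_mass k q y) \<partial>count_space UNIV) = 1" .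
qed (use nb_mass_nonneg[OF assms] in auto)

lemma nn_integral_gamma_kernel:
  fixes k r :: real
  assumes k: "0 < k" and r: "0 < r"
  shows "(\<integral>\<^sup>+x. ennreal (if 0 < x then x powr (k - 1) * exp (- (r * x)) else 0) \<partial>lborel) =
    ennreal (Gamma k / r powr k)"
proof -
  let ?f = "\<lambda>x::real. if 0 < x then x powr (k - 1) * exp (- (r * x)) else 0"
  have "ennreal (Gamma k) =
      \<bar>r\<bar> * (\<integral>\<^sup>+t. ennreal (indicator {0..} (0 + r * t) * (0 + r * t) powr (k - 1) / exp (0 + r * t)) \<partial>lborel)"
    unfolding Gamma_conv_nn_integral_real[OF k]
    using r by (intro nn_integral_real_affine) auto
  also have "(\<integral>\<^sup>+t. ennreal (indicator {0..} (0 + r * t) * (0 + r * t) powr (k - 1) / exp (0 + r * t)) \<partial>lborel)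
      = (\<integral>\<^sup>+t. ennreal (r powr (k - 1)) * ennreal (?f t) \<partial>lborel)"
    using r by (intro nn_integral_cong)
      (auto simp: indicator_def zero_le_mult_iff powr_mult exp_minus field_simps simp flip: ennreal_mult')
  also have "\<dots> = ennreal (r powr (k - 1)) * (\<integral>\<^sup>+t. ennreal (?f t) \<partial>lborel)"
    by (rule nn_integral_cmult) measurable
  finally have "ennreal (Gamma k) =
      ennreal (r powr k) * (\<integral>\<^sup>+t. ennreal (?f t) \<partial>lborel)"
    using r by (simp add: mult.assoc[symmetric] powr_diff flip: ennreal_mult')
  then have "ennreal (1 / r powr k) * ennreal (Gamma k) =
      ennreal (1 / r powr k) * ennreal (r powr k) * (\<integral>\<^sup>+t. ennreal (?f t) \<partial>lborel)"
    by (simp add: mult.assoc)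
  then show ?thesis
    using r by (simp flip: ennreal_mult')
qed

lemma gamma_poisson_mass:
  "gamma_density k s x * pmf (poisson_pmf x) y =
     (if 0 < x then gamma_density k s x * (x ^ y / fact y * exp (- x)) else 0)"
  by (simp add: gamma_density_def)

lemma gamma_poisson_marginal:
  assumes k: "0 < k" and s: "0 < s"
  shows "(\<integral>\<^sup>+x. ennreal (gamma_density k s x * pmf (poisson_pmf x) y) \<partial>lborel) =
    ennreal (nb_mass k (1 / (s + 1)) y)"
proof -
  define C where "C = 1 / (Gamma k * s powr k * fact y)"
  have C: "0 \<le> C" using k s by (simp add: C_def)
  have eq: "gamma_density k s x * pmf (poisson_pmf x) y =
      C * (if 0 < x then x powr (k + real y - 1) * exp (- ((1 + 1 / s) * x)) else 0)" for x
  proof (cases "0 < x")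
    case True
    have "x powr (k + real y - 1) = x powr (k - 1) * x ^ y"
    proof -
      have "k + real y - 1 = (k - 1) + real y" by simp
      then show ?thesis
        using True by (simp only: powr_add powr_realpow)
    qed
    moreover have "exp (- ((1 + 1 / s) * x)) = exp (- x / s) * exp (- x)"
      by (simp add: algebra_simps flip: exp_add)
    ultimately show ?thesis
      using True by (simp add: gamma_density_def C_def)
  qed (simp add: gamma_density_def)
  have "(\<integral>\<^sup>+x. ennreal (gamma_density k s x * pmf (poisson_pmf x) y) \<partial>lborel) =
      (\<integral>\<^sup>+x. ennreal C * ennreal (if 0 < x then x powr (k + real y - 1) * exp (- ((1 + 1 / s) * x)) else 0) \<partial>lborel)"
    unfolding eq using C by (simp add: ennreal_mult')
  also have "\<dots> = ennreal C * (\<integral>\<^sup>+x. ennreal (if 0 < x then x powr (k + real y - 1) * exp (- ((1 + 1 / s) * x)) else 0) \<partial>lborel)"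
    by (rule nn_integral_cmult) measurable
  also have "\<dots> = ennreal (C * (Gamma (k + real y) / (1 + 1 / s) powr (k + real y)))"
    using k s C by (subst nn_integral_gamma_kernel) (auto simp: add_pos_nonneg simp flip: ennreal_mult')
  also have "C * (Gamma (k + real y) / (1 + 1 / s) powr (k + real y)) = nb_mass k (1 / (s + 1)) y"
  proof -
    have "pochhammer k y = Gamma (k + real y) / Gamma k"
      using k by (intro pochhammer_Gamma) (auto elim!: nonpos_Ints_cases)
    moreover have "1 + 1 / s = (s + 1) / s" "1 - 1 / (s + 1) = s / (s + 1)"
      using s by (simp_all add: field_simps)
    ultimately show ?thesis
      using s by (simp add: nb_mass_pochhammer C_def powr_add powr_divide powr_realpow power_divide)
  qed
  finally show ?thesis .
qed

section \<open>The two-group model and multiple testing rules\<close>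

text \<open>
  Joint law of \<open>(\<nu>, \<theta>, Y)\<close> for one coordinate, \<open>\<nu> = True\<close> encoding \<open>\<nu> = 1\<close>.
  The value of \<^const>\<open>poisson_pmf\<close> at non-positive rates is immaterial, as the Gamma density
  vanishes there.
\<close>

definition two_group :: "real \<Rightarrow> real \<Rightarrow> real \<Rightarrow> real \<Rightarrow> (bool \<times> real \<times> nat) measure" where
  "two_group p \<alpha> \<beta> \<delta> =
     density (count_space UNIV \<Otimes>\<^sub>M lborel \<Otimes>\<^sub>M count_space UNIV)
       (\<lambda>(\<nu>, \<theta>, y). ennreal (pmf (bernoulli_pmf p) \<nu> *
          gamma_density \<alpha> (if \<nu> then \<beta> + \<delta> else \<beta>) \<theta> * pmf (poisson_pmf \<theta>) y))"

lemma measurable_two_group_density: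
  "(\<lambda>(\<nu>, \<theta>, y). ennreal (pmf (bernoulli_pmf p) \<nu> *
      gamma_density \<alpha> (if \<nu> then \<beta> + \<delta> else \<beta>) \<theta> * pmf (poisson_pmf \<theta>) y))
   \<in> borel_measurable (count_space UNIV \<Otimes>\<^sub>M lborel \<Otimes>\<^sub>M count_space UNIV)"
proof -
  let ?M = "count_space UNIV \<Otimes>\<^sub>M lborel \<Otimes>\<^sub>M count_space UNIV :: (bool \<times> real \<times> nat) measure"
  define h where "h v y \<theta> = (if 0 < \<theta> then gamma_density \<alpha> (if v then \<beta> + \<delta> else \<beta>) \<theta> *
      (\<theta> ^ y / fact y * exp (- \<theta>)) else 0)" for v :: bool and y :: nat and \<theta> :: real
  have h[measurable]: "h v y \<in> borel_measurable borel" for v y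
    unfolding h_def gamma_density_def by measurable
  have "(\<lambda>x. ennreal (pmf (bernoulli_pmf p) (fst x) * h (fst x) (snd (snd x)) (fst (snd x))))
      \<in> borel_measurable ?M"
  proof (rule measurable_compose_countable[where g = fst])
    fix v
    show "(\<lambda>x. ennreal (pmf (bernoulli_pmf p) v * h v (snd (snd x)) (fst (snd x))))
        \<in> borel_measurable ?M"
      by (rule measurable_compose_countable[where g = "\<lambda>x. snd (snd x)"]) measurable
  qed measurable
  then show ?thesis
    by (simp add: h_def case_prod_beta mult.assoc gamma_poisson_mass)
qed

lemma sets_two_group [measurable_cong]:
  "sets (two_group p \<alpha> \<beta> \<delta>) = sets (count_space UNIV \<Otimes>\<^sub>M lborel \<Otimes>\<^sub>M count_space UNIV)"
  by (simp add: two_group_def)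

lemma space_two_group [simp]: "space (two_group p \<alpha> \<beta> \<delta>) = UNIV"
  by (simp add: two_group_def space_pair_measure)

lemma emeasure_two_group_singleton:
  assumes "0 < \<alpha>" "0 < \<beta>" "0 < \<delta>"
  shows "emeasure (two_group p \<alpha> \<beta> \<delta>) {\<omega>. fst \<omega> = v \<and> snd (snd \<omega>) = y} =
    ennreal (pmf (bernoulli_pmf p) v * nb_mass \<alpha> (1 / ((if v then \<beta> + \<delta> else \<beta>) + 1)) y)"
proof -
  let ?C = "count_space UNIV :: nat measure" and ?B = "count_space UNIV :: bool measure"
  let ?f = "\<lambda>v \<theta> y. ennreal (pmf (bernoulli_pmf p) v *
      gamma_density \<alpha> (if v then \<beta> + \<delta> else \<beta>) \<theta> * pmf (poisson_pmf \<theta>) y)"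
  let ?A = "{\<omega>. fst \<omega> = v \<and> snd (snd \<omega>) = y} :: (bool \<times> real \<times> nat) set"
  interpret C: sigma_finite_measure ?C by (rule sigma_finite_measure_count_space)
  interpret LC: sigma_finite_measure "lborel \<Otimes>\<^sub>M ?C"
    by (intro sigma_finite_pair_measure sigma_finite_lborel sigma_finite_measure_count_space)
  have A[measurable]: "?A \<in> sets (?B \<Otimes>\<^sub>M lborel \<Otimes>\<^sub>M ?C)"
  proof -
    have "{\<omega> \<in> space (?B \<Otimes>\<^sub>M lborel \<Otimes>\<^sub>M ?C). fst \<omega> = v \<and> snd (snd \<omega>) = y}
        \<in> sets (?B \<Otimes>\<^sub>M lborel \<Otimes>\<^sub>M ?C)" by measurable
    then show ?thesis by (simp add: space_pair_measure)
  qed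
  note f[measurable] = measurable_two_group_density[of p \<alpha> \<beta> \<delta>]
  let ?g = "\<lambda>x. (case x of (v, \<theta>, y) \<Rightarrow> ?f v \<theta> y) * indicator ?A x"
  have g[measurable]: "?g \<in> borel_measurable (?B \<Otimes>\<^sub>M lborel \<Otimes>\<^sub>M ?C)" by measurable
  have "emeasure (two_group p \<alpha> \<beta> \<delta>) ?A = (\<integral>\<^sup>+x. ?g x \<partial>(?B \<Otimes>\<^sub>M lborel \<Otimes>\<^sub>M ?C))"
    unfolding two_group_def by (rule emeasure_density) measurable
  also have "\<dots> = (\<integral>\<^sup>+v'. \<integral>\<^sup>+x. ?g (v', x) \<partial>(lborel \<Otimes>\<^sub>M ?C) \<partial>?B)"
    by (rule LC.nn_integral_fst[symmetric]) measurable
  also have "\<dots> = (\<integral>\<^sup>+v'. (\<integral>\<^sup>+\<theta>. \<integral>\<^sup>+y'. ?g (v', \<theta>, y') \<partial>?C \<partial>lborel) \<partial>?B)"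
    by (intro nn_integral_cong C.nn_integral_fst[symmetric]) measurable
  also have "\<dots> = (\<integral>\<^sup>+v'. (\<integral>\<^sup>+\<theta>. ?f v' \<theta> y \<partial>lborel) * indicator {v} v' \<partial>?B)"
  proof (intro nn_integral_cong)
    fix v'
    have "(\<integral>\<^sup>+y'. ?g (v', \<theta>, y') \<partial>?C) = ?f v' \<theta> y * indicator {v} v'" for \<theta>
    proof -
      have "(\<integral>\<^sup>+y'. ?g (v', \<theta>, y') \<partial>?C) =
          (\<integral>\<^sup>+y'. (?f v' \<theta> y' * indicator {v} v') * indicator {y} y' \<partial>?C)"
        by (intro nn_integral_cong) (auto split: split_indicator)
      also have "\<dots> = ?f v' \<theta> y * indicator {v} v'"
        by (subst nn_integral_indicator_singleton) auto
      finally show ?thesis .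
    qed
    then show "(\<integral>\<^sup>+\<theta>. \<integral>\<^sup>+y'. ?g (v', \<theta>, y') \<partial>?C \<partial>lborel) =
        (\<integral>\<^sup>+\<theta>. ?f v' \<theta> y \<partial>lborel) * indicator {v} v'"
      by (simp split: split_indicator)
  qed
  also have "\<dots> = (\<integral>\<^sup>+\<theta>. ?f v \<theta> y \<partial>lborel)"
    by (subst nn_integral_indicator_singleton) auto
  also have "\<dots> = (\<integral>\<^sup>+\<theta>. ennreal (pmf (bernoulli_pmf p) v) *
      ennreal (gamma_density \<alpha> (if v then \<beta> + \<delta> else \<beta>) \<theta> * pmf (poisson_pmf \<theta>) y) \<partial>lborel)"
    by (simp add: mult.assoc ennreal_mult')
  also have "\<dots> = ennreal (pmf (bernoulli_pmf p) v) *
      (\<integral>\<^sup>+\<theta>. ennreal (gamma_density \<alpha> (if v then \<beta> + \<delta> else \<beta>) \<theta> * pmf (poisson_pmf \<theta>) y) \<partial>lborel)"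
  proof (rule nn_integral_cmult)
    show "(\<lambda>\<theta>. ennreal (gamma_density \<alpha> (if v then \<beta> + \<delta> else \<beta>) \<theta> * pmf (poisson_pmf \<theta>) y))
        \<in> borel_measurable lborel"
      unfolding gamma_poisson_mass unfolding gamma_density_def by measurable
  qed
  also have "\<dots> = ennreal (pmf (bernoulli_pmf p) v) *
      ennreal (nb_mass \<alpha> (1 / ((if v then \<beta> + \<delta> else \<beta>) + 1)) y)"
    using assms by (subst gamma_poisson_marginal) auto
  finally show ?thesis
    by (simp add: ennreal_mult')
qed

lemma distr_two_group:
  assumes "0 < \<alpha>" "0 < \<beta>" "0 < \<delta>"
  shows "distr (two_group p \<alpha> \<beta> \<delta>) (count_space UNIV) (\<lambda>\<omega>. (fst \<omega>, snd (snd \<omega>))) =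
    measure_pmf (bernoulli_pmf p \<bind>
      (\<lambda>v. map_pmf (Pair v) (nb_pmf \<alpha> (1 / ((if v then \<beta> + \<delta> else \<beta>) + 1)))))"
    (is "?D = measure_pmf ?P")
proof (rule measure_eqI_countable)
  fix x :: "bool \<times> nat" assume "x \<in> UNIV"
  obtain v y where x: "x = (v, y)" by fastforce
  have m: "(\<lambda>\<omega>. (fst \<omega>, snd (snd \<omega>))) \<in> two_group p \<alpha> \<beta> \<delta> \<rightarrow>\<^sub>M count_space UNIV"
  proof -
    have "(\<lambda>\<omega>. (fst \<omega>, snd (snd \<omega>))) \<in> two_group p \<alpha> \<beta> \<delta> \<rightarrow>\<^sub>M count_space UNIV \<Otimes>\<^sub>M count_space UNIV"
      by measurable
    then show ?thesis by (simp add: pair_measure_countable)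
  qed
  define q where "q v = 1 / ((if v then \<beta> + \<delta> else \<beta>) + 1)" for v
  have q: "0 < q v" "q v \<le> 1" for v
    using assms by (auto simp: q_def)
  have "emeasure ?D {x} = emeasure (two_group p \<alpha> \<beta> \<delta>) {\<omega>. fst \<omega> = v \<and> snd (snd \<omega>) = y}"
    by (subst emeasure_distr[OF m]) (auto simp: x intro!: arg_cong[where f = "emeasure _"])
  also have "\<dots> = ennreal (pmf (bernoulli_pmf p) v * pmf (nb_pmf \<alpha> (q v)) y)"
    using assms q by (simp add: emeasure_two_group_singleton pmf_nb_pmf q_def)
  also have "\<dots> = ennreal (pmf ?P x)"
  proof -
    have eq: "pmf (map_pmf (Pair v') (nb_pmf \<alpha> (q v'))) (v, y) =
        pmf (nb_pmf \<alpha> (q v)) y * indicator {v} v'" for v'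
    proof (cases "v' = v")
      case True
      then show ?thesis using pmf_map_inj'[of "Pair v"] by (auto simp: inj_on_def)
    next
      case False
      then have "(v, y) \<notin> set_pmf (map_pmf (Pair v') (nb_pmf \<alpha> (q v')))" by auto
      then show ?thesis using False by (simp add: pmf_eq_0_set_pmf)
    qed
    show ?thesis
      unfolding q_def[symmetric] x ennreal_pmf_bind eq
      by (subst nn_integral_indicator_singleton')
        (auto simp: emeasure_pmf_single ennreal_mult' mult.commute)
  qed
  finally show "emeasure ?D {x} = emeasure (measure_pmf ?P) {x}"
    by (simp add: emeasure_pmf_single)
qed auto

lemma prob_space_two_group:
  assumes "0 < \<alpha>" "0 < \<beta>" "0 < \<delta>"
  shows "prob_space (two_group p \<alpha> \<beta> \<delta>)"
proof -
  have m: "(\<lambda>\<omega>. (fst \<omega>, snd (snd \<omega>))) \<in> two_group p \<alpha> \<beta> \<delta> \<rightarrow>\<^sub>M count_space UNIV"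
    by measurable
  have "prob_space (distr (two_group p \<alpha> \<beta> \<delta>) (count_space UNIV) (\<lambda>\<omega>. (fst \<omega>, snd (snd \<omega>))))"
    unfolding distr_two_group[OF assms] by (rule prob_space_measure_pmf)
  then show ?thesis
    by (rule prob_space_distrD[OF m])
qed

lemma emeasure_two_group_fst:
  assumes "0 < \<alpha>" "0 < \<beta>" "0 < \<delta>"
  shows "emeasure (two_group p \<alpha> \<beta> \<delta>) {\<omega>. fst \<omega> = v} = ennreal (pmf (bernoulli_pmf p) v)"
proof -
  let ?Q = "\<lambda>v. nb_pmf \<alpha> (1 / ((if v then \<beta> + \<delta> else \<beta>) + 1))"
  let ?P = "bernoulli_pmf p \<bind> (\<lambda>v. map_pmf (Pair v) (?Q v))"
  have m: "(\<lambda>\<omega>. (fst \<omega>, snd (snd \<omega>))) \<in> two_group p \<alpha> \<beta> \<delta> \<rightarrow>\<^sub>M count_space UNIV"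
    by measurable
  have "emeasure (two_group p \<alpha> \<beta> \<delta>) {\<omega>. fst \<omega> = v} =
      emeasure (distr (two_group p \<alpha> \<beta> \<delta>) (count_space UNIV) (\<lambda>\<omega>. (fst \<omega>, snd (snd \<omega>))))
        (fst -` {v})"
    by (subst emeasure_distr[OF m]) (simp_all add: vimage_def)
  also have "\<dots> = emeasure (measure_pmf (map_pmf fst ?P)) {v}"
    unfolding distr_two_group[OF assms] emeasure_map_pmf ..
  also have "map_pmf fst ?P = bernoulli_pmf p"
    unfolding map_bind_pmf map_pmf_comp fst_conv map_pmf_const bind_return_pmf' ..
  finally show ?thesis
    by (simp add: emeasure_pmf_single)
qed

definition model ::
    "nat \<Rightarrow> real \<Rightarrow> real \<Rightarrow> real \<Rightarrow> real \<Rightarrow> (nat \<Rightarrow> bool \<times> real \<times> nat) measure" where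
  "model n p \<alpha> \<beta> \<delta> = PiM {..<n} (\<lambda>_. two_group p \<alpha> \<beta> \<delta>)"

definition indicator_var :: "nat \<Rightarrow> (nat \<Rightarrow> bool \<times> real \<times> nat) \<Rightarrow> bool" where
  "indicator_var i \<omega> = fst (\<omega> i)"

definition obs :: "nat \<Rightarrow> (nat \<Rightarrow> bool \<times> real \<times> nat) \<Rightarrow> nat \<Rightarrow> nat" where
  "obs n \<omega> = (\<lambda>i\<in>{..<n}. snd (snd (\<omega> i)))"

text \<open>\<open>d i y\<close> means that \<open>H\<^sub>0\<^sub>i\<close> is rejected on data \<open>y\<close>; it may depend on all observations.\<close>

type_synonym test_rule = "nat \<Rightarrow> (nat \<Rightarrow> nat) \<Rightarrow> bool"

definition type1_error ::
    "nat \<Rightarrow> real \<Rightarrow> real \<Rightarrow> real \<Rightarrow> real \<Rightarrow> test_rule \<Rightarrow> nat \<Rightarrow> real" where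
  "type1_error n p \<alpha> \<beta> \<delta> d i =
     \<P>(\<omega> in model n p \<alpha> \<beta> \<delta>. d i (obs n \<omega>) \<bar> \<not> indicator_var i \<omega>)"

definition type2_error ::
    "nat \<Rightarrow> real \<Rightarrow> real \<Rightarrow> real \<Rightarrow> real \<Rightarrow> test_rule \<Rightarrow> nat \<Rightarrow> real" where
  "type2_error n p \<alpha> \<beta> \<delta> d i =
     \<P>(\<omega> in model n p \<alpha> \<beta> \<delta>. \<not> d i (obs n \<omega>) \<bar> indicator_var i \<omega>)"

definition bayes_risk :: "nat \<Rightarrow> real \<Rightarrow> real \<Rightarrow> real \<Rightarrow> real \<Rightarrow> test_rule \<Rightarrow> real" where
  "bayes_risk n p \<alpha> \<beta> \<delta> d =
     (\<Sum>i<n. (1 - p) * type1_error n p \<alpha> \<beta> \<delta> d i + p * type2_error n p \<alpha> \<beta> \<delta> d i)"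

definition marginal_mass :: "real \<Rightarrow> real \<Rightarrow> real \<Rightarrow> real \<Rightarrow> bool \<Rightarrow> nat \<Rightarrow> real" where
  "marginal_mass p \<alpha> \<beta> \<delta> v y =
     \<P>(\<omega> in two_group p \<alpha> \<beta> \<delta>. snd (snd \<omega>) = y \<bar> fst \<omega> = v)"

lemma marginal_mass_eq_pmf_nb:
  assumes "0 < \<alpha>" "0 < \<beta>" "0 < \<delta>" "0 < p" "p < 1"
  shows "marginal_mass p \<alpha> \<beta> \<delta> v y = pmf (nb_pmf \<alpha> (1 / ((if v then \<beta> + \<delta> else \<beta>) + 1))) y"
proof -
  have "pmf (bernoulli_pmf p) v > 0"
    using assms by (cases v) auto
  then show ?thesis
    using assms nb_mass_nonneg[of \<alpha> "1 / ((if v then \<beta> + \<delta> else \<beta>) + 1)" y]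
    by (simp add: marginal_mass_def cond_prob_def measure_def pmf_nb_pmf conj_commute
      emeasure_two_group_singleton emeasure_two_group_fst)
qed

definition bayes_oracle :: "real \<Rightarrow> real \<Rightarrow> real \<Rightarrow> real \<Rightarrow> test_rule" where
  "bayes_oracle p \<alpha> \<beta> \<delta> i y \<longleftrightarrow>
     marginal_mass p \<alpha> \<beta> \<delta> True (y i) / marginal_mass p \<alpha> \<beta> \<delta> False (y i) > (1 - p) / p"

lemma
  assumes pos: "0 < \<alpha>" "0 < \<beta>" "0 < \<delta>" and i: "i < n"
  shows sets_indicator_obs:
      "{\<omega> \<in> space (model n p \<alpha> \<beta> \<delta>). indicator_var i \<omega> = v \<and> Q (obs n \<omega>)}
        \<in> sets (model n p \<alpha> \<beta> \<delta>)"
    and emeasure_indicator: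
      "emeasure (model n p \<alpha> \<beta> \<delta>) {\<omega> \<in> space (model n p \<alpha> \<beta> \<delta>). indicator_var i \<omega> = v} =
        ennreal (pmf (bernoulli_pmf p) v)"
    and emeasure_indicator_obs:
      "emeasure (model n p \<alpha> \<beta> \<delta>) {\<omega> \<in> space (model n p \<alpha> \<beta> \<delta>). indicator_var i \<omega> = v \<and> Q (obs n \<omega>)} =
        (\<integral>\<^sup>+y. (\<Prod>j\<in>{..<n} - {i}. emeasure (two_group p \<alpha> \<beta> \<delta>) {\<omega>. snd (snd \<omega>) = y j}) *
          ennreal (pmf (bernoulli_pmf p) v * nb_mass \<alpha> (1 / ((if v then \<beta> + \<delta> else \<beta>) + 1)) (y i)) *
          indicator {y. Q y} y \<partial>count_space (PiE {..<n} (\<lambda>_. UNIV)))"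
proof -
  let ?T = "two_group p \<alpha> \<beta> \<delta>" and ?M = "model n p \<alpha> \<beta> \<delta>"
  interpret T: prob_space ?T by (rule prob_space_two_group[OF pos])
  interpret product_sigma_finite "\<lambda>_ :: nat. ?T" by unfold_locales
  have prod: "emeasure ?M (PiE {..<n} A) = (\<Prod>j<n. emeasure ?T (A j))"
    if "\<And>j. j < n \<Longrightarrow> A j \<in> sets ?T" for A
    unfolding model_def using that by (intro emeasure_PiM) auto
  have set1[measurable]: "{\<omega>. fst \<omega> = w} \<in> sets ?T" for w
  proof -
    have "{\<omega> \<in> space ?T. fst \<omega> = w} \<in> sets ?T" by measurable
    then show ?thesis by simp
  qed
  have set2[measurable]: "{\<omega>. snd (snd \<omega>) = y} \<in> sets ?T" for y
  proof -
    have "{\<omega> \<in> space ?T. snd (snd \<omega>) = y} \<in> sets ?T" by measurable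
    then show ?thesis by simp
  qed
  have sp: "space ?M = PiE {..<n} (\<lambda>_. UNIV)"
    by (simp add: model_def space_PiM)
  have split: "(\<Prod>j<n. g j) = (\<Prod>j\<in>{..<n} - {i}. g j) * g i" for g :: "nat \<Rightarrow> ennreal"
    using i by (subst prod.remove[of _ i]) (auto simp: mult.commute)
  show "emeasure ?M {\<omega> \<in> space ?M. indicator_var i \<omega> = v} = ennreal (pmf (bernoulli_pmf p) v)"
  proof -
    let ?A = "\<lambda>j. if j = i then {\<omega> :: bool \<times> real \<times> nat. fst \<omega> = v} else UNIV"
    have "{\<omega> \<in> space ?M. indicator_var i \<omega> = v} = PiE {..<n} ?A"
    proof (intro set_eqI iffI)
      fix \<omega> assume "\<omega> \<in> {\<omega> \<in> space ?M. indicator_var i \<omega> = v}"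
      then show "\<omega> \<in> PiE {..<n} ?A"
        unfolding sp indicator_var_def PiE_iff by simp
    next
      fix \<omega> assume *: "\<omega> \<in> PiE {..<n} ?A"
      have "\<omega> i \<in> ?A i" using PiE_mem[OF *, of i] i by simp
      with * show "\<omega> \<in> {\<omega> \<in> space ?M. indicator_var i \<omega> = v}"
        unfolding sp indicator_var_def PiE_iff by simp
    qed
    also have "emeasure ?M \<dots> = (\<Prod>j<n. emeasure ?T (?A j))"
      by (intro prod) (use sets.top[of ?T] in auto)
    also have "\<dots> = ennreal (pmf (bernoulli_pmf p) v)"
      unfolding split using T.emeasure_space_1 by (simp add: emeasure_two_group_fst pos)
    finally show ?thesis .
  qed
  let ?E = "PiE {..<n} (\<lambda>_. UNIV :: nat set)"
  have cE: "countable ?E" by (intro countable_PiE) auto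
  define B where "B y = PiE {..<n}
    (\<lambda>j. {\<omega> :: bool \<times> real \<times> nat. snd (snd \<omega>) = y j} \<inter> (if j = i then {\<omega>. fst \<omega> = v} else UNIV))" for y :: "nat \<Rightarrow> nat"
  have setA: "{\<omega>. snd (snd \<omega>) = y j} \<inter> (if j = i then {\<omega>. fst \<omega> = v} else UNIV) \<in> sets ?T" for y j
    using sets.top[of ?T] by (intro sets.Int set2) auto
  have B_sets: "B y \<in> sets ?M" for y
    unfolding B_def model_def using setA by (intro sets_PiM_I_finite) auto
  have decomp: "{\<omega> \<in> space ?M. indicator_var i \<omega> = v \<and> Q (obs n \<omega>)} = (\<Union>y\<in>{y\<in>?E. Q y}. B y)"
  proof (intro equalityI subsetI)
    fix \<omega> assume *: "\<omega> \<in> {\<omega> \<in> space ?M. indicator_var i \<omega> = v \<and> Q (obs n \<omega>)}"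
    then have "\<omega> \<in> B (obs n \<omega>)"
      unfolding B_def sp indicator_var_def obs_def by (auto simp: PiE_iff)
    moreover have "obs n \<omega> \<in> ?E" by (simp add: obs_def)
    ultimately show "\<omega> \<in> (\<Union>y\<in>{y\<in>?E. Q y}. B y)" using * by blast
  next
    fix \<omega> assume "\<omega> \<in> (\<Union>y\<in>{y\<in>?E. Q y}. B y)"
    then obtain y where y: "y \<in> ?E" "Q y" "\<omega> \<in> B y" by blast
    then have "obs n \<omega> = y"
      by (intro ext) (auto simp: B_def obs_def PiE_iff extensional_def restrict_def)
    moreover have "fst (\<omega> i) = v"
      using PiE_mem[OF y(3)[unfolded B_def], of i] i by simp
    moreover have "\<omega> \<in> space ?M"
      using y(3) by (auto simp: B_def sp PiE_iff)
    ultimately show "\<omega> \<in> {\<omega> \<in> space ?M. indicator_var i \<omega> = v \<and> Q (obs n \<omega>)}"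
      using y(2) by (simp add: indicator_var_def)
  qed
  have cQ: "countable {y \<in> ?E. Q y}" by (rule countable_subset[OF _ cE]) auto
  show "{\<omega> \<in> space ?M. indicator_var i \<omega> = v \<and> Q (obs n \<omega>)} \<in> sets ?M"
    unfolding decomp using B_sets cQ by (intro sets.countable_UN') auto
  have disj: "disjoint_family_on B {y \<in> ?E. Q y}"
  proof (unfold disjoint_family_on_def, intro ballI impI)
    fix y z assume yz: "y \<in> {y \<in> ?E. Q y}" "z \<in> {y \<in> ?E. Q y}" "y \<noteq> z"
    show "B y \<inter> B z = {}"
    proof (rule ccontr)
      assume "B y \<inter> B z \<noteq> {}"
      then obtain \<omega> where "\<omega> \<in> B y" "\<omega> \<in> B z" by blast
      then have "y j = z j" if "j < n" for j
        using that by (auto simp: B_def PiE_iff)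
      then have "y = z"
        using yz by (intro PiE_ext[of y "{..<n}" _ z]) auto
      with yz(3) show False by simp
    qed
  qed
  have B_em: "emeasure ?M (B y) =
      (\<Prod>j\<in>{..<n} - {i}. emeasure ?T {\<omega>. snd (snd \<omega>) = y j}) *
        ennreal (pmf (bernoulli_pmf p) v * nb_mass \<alpha> (1 / ((if v then \<beta> + \<delta> else \<beta>) + 1)) (y i))" for y
  proof -
    have "emeasure ?M (B y) = (\<Prod>j<n. emeasure ?T
        ({\<omega>. snd (snd \<omega>) = y j} \<inter> (if j = i then {\<omega>. fst \<omega> = v} else UNIV)))"
      unfolding B_def by (intro prod setA)
    also have "\<dots> = (\<Prod>j\<in>{..<n} - {i}. emeasure ?T {\<omega>. snd (snd \<omega>) = y j}) *
        emeasure ?T {\<omega>. fst \<omega> = v \<and> snd (snd \<omega>) = y i}"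
      unfolding split by (auto intro!: arg_cong2[where f = "(*)"] prod.cong arg_cong[where f = "emeasure _"])
    finally show ?thesis
      by (simp add: emeasure_two_group_singleton pos)
  qed
  have "emeasure ?M {\<omega> \<in> space ?M. indicator_var i \<omega> = v \<and> Q (obs n \<omega>)} =
      (\<integral>\<^sup>+y. emeasure ?M (B y) \<partial>count_space {y \<in> ?E. Q y})"
    unfolding decomp using B_sets by (intro emeasure_UN_countable cQ disj) auto
  also have "\<dots> = (\<integral>\<^sup>+y. emeasure ?M (B y) * indicator {y. Q y} y \<partial>count_space ?E)"
  proof -
    have "{y \<in> ?E. Q y} \<subseteq> ?E" by auto
    then show ?thesis
      by (subst (1 2) nn_integral_count_space_indicator)
        (auto intro!: nn_integral_cong split: split_indicator)
  qed
  finally show "emeasure ?M {\<omega> \<in> space ?M. indicator_var i \<omega> = v \<and> Q (obs n \<omega>)} =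
        (\<integral>\<^sup>+y. (\<Prod>j\<in>{..<n} - {i}. emeasure ?T {\<omega>. snd (snd \<omega>) = y j}) *
          ennreal (pmf (bernoulli_pmf p) v * nb_mass \<alpha> (1 / ((if v then \<beta> + \<delta> else \<beta>) + 1)) (y i)) *
          indicator {y. Q y} y \<partial>count_space ?E)"
    by (simp only: B_em)
qed

lemma prob_space_model:
  assumes "0 < \<alpha>" "0 < \<beta>" "0 < \<delta>"
  shows "prob_space (model n p \<alpha> \<beta> \<delta>)"
  unfolding model_def by (intro prob_space_PiM prob_space_two_group assms)

lemma bayes_oracle_optimal:
  assumes pos: "0 < \<alpha>" "0 < \<beta>" "0 < \<delta>" and p: "0 < p" "p < 1"
  shows "bayes_risk n p \<alpha> \<beta> \<delta> (bayes_oracle p \<alpha> \<beta> \<delta>) \<le> bayes_risk n p \<alpha> \<beta> \<delta> d"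
  unfolding bayes_risk_def
proof (rule sum_mono)
  fix i assume "i \<in> {..<n}"
  then have i: "i < n" by simp
  let ?M = "model n p \<alpha> \<beta> \<delta>"
  interpret M: prob_space ?M by (rule prob_space_model[OF pos])
  define w where "w v y = pmf (bernoulli_pmf p) v *
      nb_mass \<alpha> (1 / ((if v then \<beta> + \<delta> else \<beta>) + 1)) y" for v y
  define c where "c y = (\<Prod>j\<in>{..<n} - {i}. emeasure (two_group p \<alpha> \<beta> \<delta>) {\<omega>. snd (snd \<omega>) = y j})"
    for y :: "nat \<Rightarrow> nat"
  define loss where "loss d = (1 - p) * type1_error n p \<alpha> \<beta> \<delta> d i + p * type2_error n p \<alpha> \<beta> \<delta> d i"
    for d :: test_rule
  have loss: "ennreal (loss d) =
      (\<integral>\<^sup>+y. c y * ennreal (w (\<not> d i y) (y i)) \<partial>count_space (PiE {..<n} (\<lambda>_. UNIV)))"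
    (is "_ = ?R") and loss_nonneg: "0 \<le> loss d" for d
  proof -
    have t: "\<P>(\<omega> in ?M. \<not> indicator_var i \<omega>) = 1 - p" "\<P>(\<omega> in ?M. indicator_var i \<omega>) = p"
      using emeasure_indicator[OF pos i, of p False] emeasure_indicator[OF pos i, of p True] p
      by (auto simp: measure_def)
    have "loss d = \<P>(\<omega> in ?M. d i (obs n \<omega>) \<and> \<not> indicator_var i \<omega>) +
        \<P>(\<omega> in ?M. \<not> d i (obs n \<omega>) \<and> indicator_var i \<omega>)"
      using p by (simp add: loss_def type1_error_def type2_error_def cond_prob_def t)
    also have "\<dots> = measure ?M {\<omega> \<in> space ?M. indicator_var i \<omega> = False \<and> d i (obs n \<omega>)} +
        measure ?M {\<omega> \<in> space ?M. indicator_var i \<omega> = True \<and> \<not> d i (obs n \<omega>)}"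
      by (intro arg_cong2[where f = "(+)"] arg_cong[where f = "measure ?M"]) auto
    finally have eq: "loss d = \<dots>" .
    then show "0 \<le> loss d" by simp
    have "ennreal (loss d) =
        emeasure ?M {\<omega> \<in> space ?M. indicator_var i \<omega> = False \<and> d i (obs n \<omega>)} +
        emeasure ?M {\<omega> \<in> space ?M. indicator_var i \<omega> = True \<and> \<not> d i (obs n \<omega>)}"
      unfolding eq by (simp add: M.emeasure_eq_measure)
    also have "\<dots> = ?R"
      unfolding emeasure_indicator_obs[OF pos i, of p _ "d i"]
        emeasure_indicator_obs[OF pos i, of p _ "\<lambda>y. \<not> d i y"]
      by (subst nn_integral_add[symmetric])
        (auto intro!: nn_integral_cong simp: c_def w_def split: split_indicator)
    finally show "ennreal (loss d) = ?R" .
  qed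
  have rejects: "bayes_oracle p \<alpha> \<beta> \<delta> i y \<longleftrightarrow> w False (y i) < w True (y i)" for y
  proof -
    have marg: "marginal_mass p \<alpha> \<beta> \<delta> v z = nb_mass \<alpha> (1 / ((if v then \<beta> + \<delta> else \<beta>) + 1)) z" for v z
      using pos p by (simp add: marginal_mass_eq_pmf_nb pmf_nb_pmf)
    have "0 < nb_mass \<alpha> (1 / (\<beta> + 1)) (y i)"
      using pos by (simp add: nb_mass_pochhammer pochhammer_pos field_simps)
    then show ?thesis
      using p by (simp add: bayes_oracle_def marg w_def field_simps)
  qed
  have "w (\<not> bayes_oracle p \<alpha> \<beta> \<delta> i y) (y i) \<le> w (\<not> d i y) (y i)" for y
    using rejects[of y] by (cases "bayes_oracle p \<alpha> \<beta> \<delta> i y"; cases "d i y") simp_all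
  then have "ennreal (loss (bayes_oracle p \<alpha> \<beta> \<delta>)) \<le> ennreal (loss d)"
    unfolding loss by (intro nn_integral_mono mult_left_mono ennreal_leI) simp_all
  then show "(1 - p) * type1_error n p \<alpha> \<beta> \<delta> (bayes_oracle p \<alpha> \<beta> \<delta>) i +
      p * type2_error n p \<alpha> \<beta> \<delta> (bayes_oracle p \<alpha> \<beta> \<delta>) i \<le>
      (1 - p) * type1_error n p \<alpha> \<beta> \<delta> d i + p * type2_error n p \<alpha> \<beta> \<delta> d i"
    using loss_nonneg by (simp add: loss_def[symmetric])
qed

section \<open>The one-group rule\<close>

definition slowly_varying :: "(real \<Rightarrow> real) \<Rightarrow> bool" where
  "slowly_varying L \<longleftrightarrow> (\<forall>c>0. ((\<lambda>x. L (c * x) / L x) \<longlongrightarrow> 1) at_top)"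

definition mixing_density :: "real \<Rightarrow> real \<Rightarrow> (real \<Rightarrow> real) \<Rightarrow> real \<Rightarrow> real" where
  "mixing_density K a L u = (if 0 < u then K * u powr (- a - 1) * L u else 0)"

text \<open>
  Posterior of \<open>\<kappa> = 1 / (1 + \<lambda>\<^sup>2\<tau>\<^sup>2)\<close> given \<open>Y = y\<close>, up to normalization: the Gamma--Poisson
  marginal of \<open>y\<close> given \<open>\<lambda>\<close> is proportional to \<open>\<kappa>\<^sup>\<alpha> (1 - \<kappa>)\<^sup>y\<close>, and \<^const>\<open>mixing_density\<close>
  is transported along \<open>\<lambda>\<^sup>2 = (1/\<kappa> - 1) / \<tau>\<^sup>2\<close>. The constant \<open>K\<close> cancels.
\<close>

definition kappa_weight ::
    "real \<Rightarrow> real \<Rightarrow> (real \<Rightarrow> real) \<Rightarrow> real \<Rightarrow> nat \<Rightarrow> real \<Rightarrow> real" where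
  "kappa_weight \<alpha> a L \<tau> y \<kappa> =
     \<kappa> powr (a + \<alpha> - 1) * (1 - \<kappa>) powr (real y - a - 1) * L (1 / \<tau>\<^sup>2 * (1 / \<kappa> - 1))"

definition kappa_post_mean ::
    "real \<Rightarrow> real \<Rightarrow> (real \<Rightarrow> real) \<Rightarrow> real \<Rightarrow> nat \<Rightarrow> real" where
  "kappa_post_mean \<alpha> a L \<tau> y =
     (LINT \<kappa>:{0<..<1}|lborel. \<kappa> * kappa_weight \<alpha> a L \<tau> y \<kappa>) /
     (LINT \<kappa>:{0<..<1}|lborel. kappa_weight \<alpha> a L \<tau> y \<kappa>)"

definition one_group_rule ::
    "real \<Rightarrow> real \<Rightarrow> real \<Rightarrow> (real \<Rightarrow> real) \<Rightarrow> real \<Rightarrow> test_rule" where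
  "one_group_rule \<alpha> \<delta> a L \<tau> i y \<longleftrightarrow>
     1 - kappa_post_mean \<alpha> a L \<tau> (y i) > \<delta> / (2 * (\<delta> + 1))"

end

theory Submission
  imports Defs
begin

text \<open>
  A rule that decides about \<open>H\<^sub>0\<^sub>i\<close> from \<open>Y\<^sub>i\<close> alone by the same criterion for all \<open>i\<close> has Bayes
  risk \<open>n ((1 - p) t\<^sub>1 + p t\<^sub>2)\<close>, with \<open>t\<^sub>1\<close> and \<open>t\<^sub>2\<close> negative binomial probabilities.
  Both rules to be compared have this form, so the ratio of their risks is a ratio of two such
  expressions.

  The null distribution has mass \<open>(\<beta> + 1)\<^bsup>-\<alpha>\<^esup> \<ge> 1 - \<alpha> \<beta>\<close> at \<open>0\<close>, and
  \<open>\<beta> \<propto> p\<^bsup>C1\<^esup>\<close> with \<open>C1 > 1\<close> is of smaller order than \<open>p\<close>. On the scale \<open>p\<close>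
  a rule that accepts at \<open>0\<close> therefore has negligible type I error, whatever it does elsewhere,
  and its risk is governed by its type II error.

  For the lower bound it suffices that the oracle is optimal and has positive risk. For the upper
  bound, the oracle accepts at \<open>0\<close>, because the likelihood ratio there is at most \<open>1\<close>; so
  its type II error is at least the mass \<open>(\<beta> + \<delta> + 1)\<^bsup>-\<alpha>\<^esup>\<close> of \<open>0\<close> under
  the alternative, whence the factor \<open>(\<delta> + 1)\<^bsup>\<alpha>\<^esup>\<close> (\<open>bayes_oracle_risk_ge\<close>).

  It remains to find where the one-group rule accepts as \<open>\<tau> \<rightarrow> 0\<close>. At \<open>y = 0\<close> the
  posterior of \<open>\<kappa>\<close> piles up at \<open>1\<close>, so the rule accepts (\<open>kappa_post_mean_0_tendsto\<close>).
  For \<open>y > a\<close> the argument of \<open>L\<close> in the posterior density tends to infinity and \<open>L\<close>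
  to a positive constant; the posterior becomes a Beta law with parameters \<open>a + \<alpha>\<close> and
  \<open>y - a\<close>, whose mean is \<open>(a + \<alpha>) / (y + \<alpha>)\<close> (\<open>kappa_post_mean_tendsto\<close>).
  The limit \<open>(y - a) / (y + \<alpha>)\<close> of \<open>1 - \<E>(\<kappa> | y)\<close> exceeds
  \<open>\<delta> / (2 (\<delta> + 1))\<close> exactly when \<open>y > T = 2 a + \<alpha> - 2 (a + \<alpha>) / (\<delta> + 2)\<close>.
  So every fixed \<open>y > T\<close> is eventually rejected, and \<open>limsup t\<^sub>2\<close> is at most the
  limiting probability of \<open>Y \<le> T\<close>. Rejection need not set in uniformly in \<open>y\<close>: it is used
  for \<open>T < y \<le> N\<close> only, and \<open>N \<rightarrow> \<infinity>\<close> after \<open>n \<rightarrow> \<infinity>\<close>.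
\<close>

section \<open>Risk of a rule that looks at one observation\<close>

text \<open>
  Projecting the product measure to coordinate \<open>i\<close> and then to \<open>(\<nu>, Y)\<close> turns the
  probability into one about the discrete mixture that \<open>distr_two_group\<close> identifies.
\<close>

lemma prob_model_coordinate:
  assumes pos: "0 < \<alpha>" "0 < \<beta>" "0 < \<delta>" and i: "i < n"
  shows "\<P>(\<omega> in model n p \<alpha> \<beta> \<delta>. D (obs n \<omega> i) \<and> indicator_var i \<omega> = v) =
    pmf (bernoulli_pmf p) v *
      measure_pmf.prob (nb_pmf \<alpha> (1 / ((if v then \<beta> + \<delta> else \<beta>) + 1))) {y. D y}"
proof -
  let ?T = "two_group p \<alpha> \<beta> \<delta>" and ?M = "model n p \<alpha> \<beta> \<delta>"
  let ?proj = "\<lambda>\<omega> :: bool \<times> real \<times> nat. (fst \<omega>, snd (snd \<omega>))"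
  let ?Q = "\<lambda>v. nb_pmf \<alpha> (1 / ((if v then \<beta> + \<delta> else \<beta>) + 1))"
  let ?P = "bernoulli_pmf p \<bind> (\<lambda>v. map_pmf (Pair v) (?Q v))"
  let ?A = "{x. D (snd x) \<and> fst x = v} :: (bool \<times> nat) set"
  have m1: "(\<lambda>\<omega>. \<omega> i) \<in> ?M \<rightarrow>\<^sub>M ?T"
    unfolding model_def using i by (intro measurable_component_singleton) auto
  have m2: "?proj \<in> ?T \<rightarrow>\<^sub>M count_space UNIV"
    by measurable
  have set2: "?proj -` ?A \<in> sets ?T"
    using measurable_sets[OF m2, of ?A] by simp
  have "\<P>(\<omega> in ?M. D (obs n \<omega> i) \<and> indicator_var i \<omega> = v) =
      measure ?M ((\<lambda>\<omega>. \<omega> i) -` (?proj -` ?A) \<inter> space ?M)"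
    using i by (intro arg_cong[where f = "measure ?M"]) (auto simp: obs_def indicator_var_def)
  also have "\<dots> = measure (distr ?M ?T (\<lambda>\<omega>. \<omega> i)) (?proj -` ?A)"
    by (rule measure_distr[OF m1 set2, symmetric])
  also have "distr ?M ?T (\<lambda>\<omega>. \<omega> i) = ?T"
    unfolding model_def using i
    by (intro distr_PiM_component prob_space_two_group pos) auto
  also have "measure ?T (?proj -` ?A) = measure (distr ?T (count_space UNIV) ?proj) ?A"
    by (subst measure_distr[OF m2]) auto
  also have "\<dots> = measure_pmf.prob ?P ?A"
    unfolding distr_two_group[OF pos] ..
  also have "\<dots> = pmf (bernoulli_pmf p) v * measure_pmf.prob (?Q v) {y. D y}"
  proof -
    have fiber: "measure_pmf.prob (map_pmf (Pair v') (?Q v')) ?A =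
        (if v' = v then measure_pmf.prob (?Q v) {y. D y} else 0)" for v'
      by (auto simp: vimage_def)
    have "emeasure (measure_pmf ?P) ?A =
        (\<integral>\<^sup>+v'. emeasure (measure_pmf (map_pmf (Pair v') (?Q v'))) ?A \<partial>measure_pmf (bernoulli_pmf p))"
      by (rule emeasure_bind_pmf)
    also have "\<dots> = (\<integral>\<^sup>+v'. ennreal (measure_pmf.prob (?Q v) {y. D y}) * indicator {v} v'
        \<partial>measure_pmf (bernoulli_pmf p))"
      unfolding measure_pmf.emeasure_eq_measure fiber
      by (intro nn_integral_cong) (auto split: split_indicator)
    also have "\<dots> = ennreal (pmf (bernoulli_pmf p) v * measure_pmf.prob (?Q v) {y. D y})"
      by (subst nn_integral_cmult_indicator) (auto simp: emeasure_pmf_single ennreal_mult' mult.commute)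
    finally show ?thesis
      by (simp add: measure_pmf.emeasure_eq_measure)
  qed
  finally show ?thesis .
qed

lemma bayes_risk_coordinatewise:
  assumes pos: "0 < \<alpha>" "0 < \<beta>" "0 < \<delta>" and p: "0 < p" "p < 1"
  shows "bayes_risk n p \<alpha> \<beta> \<delta> (\<lambda>i y. D (y i)) =
    real n * ((1 - p) * measure_pmf.prob (nb_pmf \<alpha> (1 / (\<beta> + 1))) {y. D y} +
      p * measure_pmf.prob (nb_pmf \<alpha> (1 / (\<beta> + \<delta> + 1))) {y. \<not> D y})"
proof -
  let ?M = "model n p \<alpha> \<beta> \<delta>"
  have "type1_error n p \<alpha> \<beta> \<delta> (\<lambda>i y. D (y i)) i =
        measure_pmf.prob (nb_pmf \<alpha> (1 / (\<beta> + 1))) {y. D y}"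
      and "type2_error n p \<alpha> \<beta> \<delta> (\<lambda>i y. D (y i)) i =
        measure_pmf.prob (nb_pmf \<alpha> (1 / (\<beta> + \<delta> + 1))) {y. \<not> D y}" if i: "i < n" for i
    using p prob_model_coordinate[OF pos i, of p D False]
      prob_model_coordinate[OF pos i, of p "\<lambda>_. True" False]
      prob_model_coordinate[OF pos i, of p "\<lambda>y. \<not> D y" True]
      prob_model_coordinate[OF pos i, of p "\<lambda>_. True" True]
    by (simp_all add: type1_error_def type2_error_def cond_prob_def)
  then show ?thesis
    by (simp add: bayes_risk_def)
qed

section \<open>Posterior mean of the shrinkage factor for small \<open>\<tau>\<close>\<close>

text \<open>
  A factor \<open>\<kappa>\<close> raises the parameter \<open>\<alpha>\<close> of the weight by one, so that the limit of the
  posterior mean follows from the limit of one family of integrals, at two values of its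
  parameter.
\<close>

lemma kappa_post_mean_eq_ratio:
  "kappa_post_mean \<alpha> a L \<tau> y =
     (LINT \<kappa>:{0<..<1}|lborel. kappa_weight (\<alpha> + 1) a L \<tau> y \<kappa>) /
     (LINT \<kappa>:{0<..<1}|lborel. kappa_weight \<alpha> a L \<tau> y \<kappa>)"
proof -
  have "\<kappa> * kappa_weight \<alpha> a L \<tau> y \<kappa> = kappa_weight (\<alpha> + 1) a L \<tau> y \<kappa>"
    if "\<kappa> \<in> {0<..<1}" for \<kappa>
  proof -
    have "a + (\<alpha> + 1) - 1 = 1 + (a + \<alpha> - 1)" by simp
    then show ?thesis
      using that unfolding kappa_weight_def by (simp only: powr_add) simp
  qed
  then have "(LINT \<kappa>:{0<..<1}|lborel. \<kappa> * kappa_weight \<alpha> a L \<tau> y \<kappa>) =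
      (LINT \<kappa>:{0<..<1}|lborel. kappa_weight (\<alpha> + 1) a L \<tau> y \<kappa>)"
    by (intro set_lebesgue_integral_cong) auto
  then show ?thesis
    by (simp only: kappa_post_mean_def)
qed

lemma borel_measurable_kappa_weight:
  assumes L: "L \<in> borel_measurable (restrict_space borel {0<..})" and \<tau>: "0 < \<tau>"
  shows "(\<lambda>\<kappa>. indicator {0<..<1} \<kappa> * kappa_weight b a L \<tau> y \<kappa>) \<in> borel_measurable borel"
proof -
  have [measurable]: "(\<lambda>x. indicator {0<..} x * L x) \<in> borel_measurable borel"
    using L by (simp add: borel_measurable_restrict_space_iff)
  let ?h = "\<lambda>\<kappa>. 1 / \<tau>\<^sup>2 * (1 / \<kappa> - 1)"
  have "(\<lambda>\<kappa>. indicator {0<..<1} \<kappa> * (\<kappa> powr (a + b - 1) * (1 - \<kappa>) powr (real y - a - 1) *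
      (indicator {0<..} (?h \<kappa>) * L (?h \<kappa>)))) \<in> borel_measurable borel"
    by measurable
  also have "(\<lambda>\<kappa>. indicator {0<..<1} \<kappa> * (\<kappa> powr (a + b - 1) * (1 - \<kappa>) powr (real y - a - 1) *
      (indicator {0<..} (?h \<kappa>) * L (?h \<kappa>)))) =
      (\<lambda>\<kappa>. indicator {0<..<1} \<kappa> * kappa_weight b a L \<tau> y \<kappa>)"
  proof
    fix \<kappa> :: real
    have "0 < ?h \<kappa>" if "0 < \<kappa>" "\<kappa> < 1" using that \<tau> by simp
    then show "indicator {0<..<1} \<kappa> * (\<kappa> powr (a + b - 1) * (1 - \<kappa>) powr (real y - a - 1) *
      (indicator {0<..} (?h \<kappa>) * L (?h \<kappa>))) = indicator {0<..<1} \<kappa> * kappa_weight b a L \<tau> y \<kappa>"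
      by (auto simp: kappa_weight_def indicator_def)
  qed
  finally show ?thesis .
qed

lemma borel_measurable_mixing_density:
  assumes L: "L \<in> borel_measurable (restrict_space borel {0<..})"
  shows "mixing_density K a L \<in> borel_measurable borel"
proof -
  have [measurable]: "(\<lambda>x. indicator {0<..} x * L x) \<in> borel_measurable borel"
    using L by (simp add: borel_measurable_restrict_space_iff)
  have "mixing_density K a L =
      (\<lambda>u. indicator {0<..} u * (K * u powr (- a - 1)) * (indicator {0<..} u * L u))"
    by (auto simp: mixing_density_def indicator_def fun_eq_iff)
  then show ?thesis by simp
qed

text \<open>
  For \<open>y = 0\<close> the factor \<open>(1 - \<kappa>)\<^bsup>-a-1\<^esup>\<close> is not integrable at \<open>1\<close>, and a bound on
  \<open>L\<close> does not help: the weight is integrable only because the prior is proper. The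
  substitution back to \<open>u = \<lambda>\<^sup>2\<close>, that is \<open>\<kappa> = 1 / (1 + \<tau>\<^sup>2 u)\<close>, brings the prior
  into view; up to a constant the integral is the prior mean of \<open>\<kappa>\<^bsup>b\<^esup>\<close>, the likelihood
  of the observation \<open>0\<close> when the Gamma shape is \<open>b\<close>.
\<close>

lemma kappa_weight_integral_0:
  assumes L: "L \<in> borel_measurable (restrict_space borel {0<..})"
    and prior: "integrable lborel (mixing_density K a L)"
    and K: "0 < K" and \<tau>: "0 < \<tau>" and b: "0 \<le> b"
  shows "(LINT \<kappa>:{0<..<1}|lborel. kappa_weight b a L \<tau> 0 \<kappa>) =
    (\<tau>\<^sup>2) powr (- a) / K * (\<integral>u. (1 / (1 + \<tau>\<^sup>2 * u)) powr b * mixing_density K a L u \<partial>lborel)"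
proof -
  let ?f = "kappa_weight b a L \<tau> 0" and ?S = "{0::real<..}"
  let ?C = "(\<tau>\<^sup>2) powr (- a) / K"
  define g where "g u = 1 / (1 + \<tau>\<^sup>2 * u)" for u
  define g' where "g' u = - \<tau>\<^sup>2 / (1 + \<tau>\<^sup>2 * u)\<^sup>2" for u
  define G where "G u = g u powr b * mixing_density K a L u" for u
  have g: "0 < g u" "g u < 1" if "0 < u" for u
    using that \<tau> by (auto simp: g_def add_pos_pos)
  have [measurable]: "mixing_density K a L \<in> borel_measurable borel"
    by (rule borel_measurable_mixing_density[OF L])
  have intG: "integrable lborel G"
  proof (rule Bochner_Integration.integrable_bound[OF prior])
    show "G \<in> borel_measurable lborel" unfolding G_def g_def by measurable
    have "norm (G u) \<le> norm (mixing_density K a L u)" for u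
    proof (cases "0 < u")
      case True
      have "g u powr b \<le> 1 powr b" using g[OF True] b by (intro powr_mono2) auto
      then show ?thesis by (simp add: G_def abs_mult mult_left_le_one_le)
    qed (simp add: G_def mixing_density_def)
    then show "AE u in lborel. norm (G u) \<le> norm (mixing_density K a L u)" by simp
  qed
  have image: "g ` ?S = {0<..<1}"
  proof (intro equalityI subsetI)
    fix \<kappa> :: real assume \<kappa>: "\<kappa> \<in> {0<..<1}"
    then have "\<kappa> = g ((1 / \<kappa> - 1) / \<tau>\<^sup>2)" using \<tau> by (simp add: g_def)
    moreover have "(1 / \<kappa> - 1) / \<tau>\<^sup>2 \<in> ?S" using \<kappa> \<tau> by simp
    ultimately show "\<kappa> \<in> g ` ?S" by blast
  qed (use g in auto)
  \<comment> \<open>The Jacobian times the weight: the powers of \<open>1 + \<tau>\<^sup>2 u\<close> combine to \<open>(1 + \<tau>\<^sup>2 u)\<^bsup>-b\<^esup>\<close>.\<close>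
  have transform: "\<bar>g' u\<bar> * ?f (g u) = ?C * G u" if u: "0 < u" for u
  proof -
    define s where "s = \<tau>\<^sup>2 * u"
    have s: "0 < s" using u \<tau> by (simp add: s_def)
    have gs: "g u = 1 / (1 + s)" "1 - g u = s / (1 + s)"
      using s by (simp_all add: g_def divide_simps flip: s_def)
    have arg: "1 / \<tau>\<^sup>2 * (1 / g u - 1) = u"
      using \<tau> by (simp add: g_def)
    have "\<bar>g' u\<bar> = \<tau>\<^sup>2 * (1 + s) powr (-2)"
      using s by (simp add: g'_def s_def[symmetric] powr_minus abs_mult divide_inverse powr_numeral)
    moreover have "g u powr x = (1 + s) powr (- x)" for x
      unfolding gs(1) using s by (simp add: powr_divide powr_minus_divide)
    moreover have "(1 - g u) powr x = s powr x * (1 + s) powr (- x)" for x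
      unfolding gs(2) using s by (simp add: powr_divide powr_minus_divide)
    ultimately have "\<bar>g' u\<bar> * ?f (g u) = \<tau>\<^sup>2 * (1 + s) powr (-2) * ((1 + s) powr (- (a + b - 1)) *
        (s powr (- a - 1) * (1 + s) powr (a + 1)) * L u)"
      unfolding kappa_weight_def arg by (simp add: add.commute)
    also have "\<dots> = ((1 + s) powr (-2) * (1 + s) powr (- (a + b - 1)) * (1 + s) powr (a + 1)) *
        (\<tau>\<^sup>2 * s powr (- a - 1)) * L u"
      by (simp add: mult_ac)
    also have "(1 + s) powr (-2) * (1 + s) powr (- (a + b - 1)) * (1 + s) powr (a + 1) =
        (1 + s) powr (-2 + - (a + b - 1) + (a + 1))"
      by (simp only: powr_add)
    also have "-2 + - (a + b - 1) + (a + 1) = - b"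
      by simp
    also have "(1 + s) powr (- b) = g u powr b"
      unfolding gs(1) using s by (simp add: powr_divide powr_minus_divide)
    also have "\<tau>\<^sup>2 * s powr (- a - 1) = (\<tau>\<^sup>2) powr (- a) * u powr (- a - 1)"
      using \<tau> u by (simp add: s_def powr_mult powr_diff)
    finally show ?thesis
      using u K by (simp add: G_def mixing_density_def)
  qed
  have zero: "G u = 0" if "\<not> 0 < u" for u
    using that by (simp add: G_def mixing_density_def)
  have ind: "indicator ?S u *\<^sub>R (\<bar>g' u\<bar> * ?f (g u)) = ?C * G u" for u
    using transform[of u] zero[of u] by (auto simp: indicator_def)
  have Gm[measurable]: "G \<in> borel_measurable lborel"
    using intG by (rule borel_measurable_integrable)
  have abs: "(\<lambda>u. \<bar>g' u\<bar> * ?f (g u)) absolutely_integrable_on ?S"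
    unfolding set_integrable_def ind using intG by (subst integrable_completion) auto
  have "integral ?S (\<lambda>u. \<bar>g' u\<bar> * ?f (g u)) = (LINT u:?S|lebesgue. \<bar>g' u\<bar> * ?f (g u))"
    by (rule set_lebesgue_integral_eq_integral(2)[OF abs, symmetric])
  also have "\<dots> = (\<integral>u. ?C * G u \<partial>lborel)"
    unfolding set_lebesgue_integral_def ind by (rule integral_completion) measurable
  finally have int: "integral ?S (\<lambda>u. \<bar>g' u\<bar> * ?f (g u)) = ?C * (\<integral>u. G u \<partial>lborel)"
    by simp
  have deriv: "(g has_field_derivative g' u) (at u within ?S)" if "u \<in> ?S" for u
  proof -
    have "1 + \<tau>\<^sup>2 * u \<noteq> 0" using that \<tau> by (auto simp: add_pos_pos less_imp_neq[THEN not_sym])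
    then show ?thesis
      unfolding g_def g'_def by (auto intro!: derivative_eq_intros simp: power2_eq_square)
  qed
  have inj: "inj_on g ?S"
    using \<tau> by (auto simp: g_def inj_on_def add_pos_pos less_imp_neq[THEN not_sym] field_simps)
  have "?f absolutely_integrable_on {0<..<1} \<and> integral {0<..<1} ?f = ?C * (\<integral>u. G u \<partial>lborel)"
    using has_absolute_integral_change_of_variables_1'[OF _ deriv inj, of ?f] abs int
    unfolding image by auto
  moreover have "(LINT \<kappa>:{0<..<1}|lborel. ?f \<kappa>) = (LINT \<kappa>:{0<..<1}|lebesgue. ?f \<kappa>)"
    unfolding set_lebesgue_integral_def real_scaleR_def
    by (rule integral_completion[symmetric])
      (simp add: borel_measurable_kappa_weight[OF L \<tau>])
  ultimately have "(LINT \<kappa>:{0<..<1}|lborel. ?f \<kappa>) = ?C * (\<integral>u. G u \<partial>lborel)"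
    by (simp add: set_lebesgue_integral_eq_integral(2))
  then show ?thesis
    by (simp add: G_def g_def)
qed

text \<open>
  For each fixed \<open>u\<close> the factor \<open>1 / (1 + \<tau>\<^sup>2 u)\<close> tends to \<open>1\<close> as \<open>\<tau> \<rightarrow> 0\<close>, so
  numerator and denominator both tend to the total mass of the prior, which also dominates.
\<close>

lemma kappa_post_mean_0_tendsto:
  assumes L: "L \<in> borel_measurable (restrict_space borel {0<..})"
    and L_pos: "\<And>x. 0 < x \<Longrightarrow> 0 < L x"
    and prior: "(\<integral>\<^sup>+u. ennreal (mixing_density K a L u) \<partial>lborel) = 1"
    and K: "0 < K" and \<alpha>: "0 \<le> \<alpha>"
    and \<tau>: "\<And>n. 0 < \<tau> n" and \<tau>_lim: "\<tau> \<longlonglongrightarrow> 0"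
  shows "(\<lambda>n. kappa_post_mean \<alpha> a L (\<tau> n) 0) \<longlonglongrightarrow> 1"
proof -
  let ?\<pi> = "mixing_density K a L"
  have \<pi>_nonneg: "0 \<le> ?\<pi> u" for u
    using less_imp_le[OF L_pos[of u]] K by (simp add: mixing_density_def)
  have \<pi>_meas[measurable]: "?\<pi> \<in> borel_measurable borel"
    by (rule borel_measurable_mixing_density[OF L])
  have \<pi>_int: "integrable lborel ?\<pi>"
    using prior \<pi>_nonneg by (intro integrableI_nonneg) auto
  have \<pi>_1: "(\<integral>u. ?\<pi> u \<partial>lborel) = 1"
    using prior \<pi>_nonneg by (subst integral_eq_nn_integral) auto
  define J where "J b n = (\<integral>u. (1 / (1 + (\<tau> n)\<^sup>2 * u)) powr b * ?\<pi> u \<partial>lborel)" for b n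
  have J: "J b \<longlonglongrightarrow> 1" if b: "0 \<le> b" for b
  proof -
    have "J b \<longlonglongrightarrow> (\<integral>u. ?\<pi> u \<partial>lborel)"
      unfolding J_def
    proof (rule integral_dominated_convergence[where w = ?\<pi>])
      have "(\<lambda>n. (1 / (1 + (\<tau> n)\<^sup>2 * u)) powr b * ?\<pi> u) \<longlonglongrightarrow> (1 / (1 + 0\<^sup>2 * u)) powr b * ?\<pi> u" for u
        by (intro tendsto_intros \<tau>_lim) auto
      then show "AE u in lborel. (\<lambda>n. (1 / (1 + (\<tau> n)\<^sup>2 * u)) powr b * ?\<pi> u) \<longlonglongrightarrow> ?\<pi> u"
        by simp
      fix n
      have "norm ((1 / (1 + (\<tau> n)\<^sup>2 * u)) powr b * ?\<pi> u) \<le> ?\<pi> u" for u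
      proof (cases "0 < u")
        case True
        have "(1 / (1 + (\<tau> n)\<^sup>2 * u)) powr b \<le> 1 powr b"
          using True b by (intro powr_mono2) (auto simp: divide_le_eq add_pos_nonneg)
        then show ?thesis using \<pi>_nonneg[of u] by (simp add: abs_mult mult_left_le_one_le)
      qed (simp add: mixing_density_def)
      then show "AE u in lborel. norm ((1 / (1 + (\<tau> n)\<^sup>2 * u)) powr b * ?\<pi> u) \<le> ?\<pi> u"
        by simp
    qed (use \<pi>_int in measurable)
    then show ?thesis by (simp add: \<pi>_1)
  qed
  have "kappa_post_mean \<alpha> a L (\<tau> n) 0 = J (\<alpha> + 1) n / J \<alpha> n" for n
    unfolding kappa_post_mean_eq_ratio J_def
    using kappa_weight_integral_0[OF L \<pi>_int K \<tau>[of n]] K \<alpha> \<tau>[of n] by simp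
  moreover have "(\<lambda>n. J (\<alpha> + 1) n / J \<alpha> n) \<longlonglongrightarrow> 1 / 1"
    using \<alpha> by (intro tendsto_divide J) auto
  ultimately show ?thesis by simp
qed

text \<open>
  For \<open>y > a\<close> the weight without \<open>L\<close> is an integrable Beta kernel \<open>B\<close>, so \<open>M B\<close>
  dominates and the integrals tend to \<open>l\<close> times Beta functions; the constant \<open>l\<close> cancels in
  the ratio.
\<close>

lemma kappa_post_mean_tendsto:
  assumes L: "L \<in> borel_measurable (restrict_space borel {0<..})"
    and L_nonneg: "\<And>x. 0 < x \<Longrightarrow> 0 \<le> L x"
    and M: "\<And>x. 0 < x \<Longrightarrow> L x \<le> M"
    and L_lim: "(L \<longlongrightarrow> l) at_top" and l: "l \<noteq> 0"
    and \<alpha>: "0 < \<alpha>" and a: "0 < a" and y: "a < real y"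
    and \<tau>: "\<And>n. 0 < \<tau> n" and \<tau>_lim: "\<tau> \<longlonglongrightarrow> 0"
  shows "(\<lambda>n. kappa_post_mean \<alpha> a L (\<tau> n) y) \<longlonglongrightarrow> (a + \<alpha>) / (real y + \<alpha>)"
proof -
  define J where "J b n = (LINT \<kappa>:{0<..<1}|lborel. kappa_weight b a L (\<tau> n) y \<kappa>)" for b n
  have J: "J b \<longlonglongrightarrow> l * Beta (a + b) (real y - a)" if b: "0 < b" for b
  proof -
    define B where "B \<kappa> = \<kappa> powr (a + b - 1) * (1 - \<kappa>) powr (real y - a - 1)" for \<kappa>
    have intB: "set_integrable lborel {0<..<1} B"
      using integrable_Beta[of "a + b" "real y - a"] a b y unfolding B_def
      by (rule_tac set_integrable_subset) auto
    have "(LINT \<kappa>:{0<..<1}|lborel. B \<kappa>) = integral {0<..<1} B"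
      by (rule set_borel_integral_eq_integral(2)[OF intB])
    also have "\<dots> = Beta (a + b) (real y - a)"
      using has_integral_Beta_real[of "a + b" "real y - a"] a b y
      by (intro integral_unique) (simp add: has_integral_Icc_iff_Ioo B_def[abs_def])
    finally have LB: "(LINT \<kappa>:{0<..<1}|lborel. B \<kappa>) = Beta (a + b) (real y - a)" .
    have ev: "(\<lambda>n. L (1 / (\<tau> n)\<^sup>2 * (1 / \<kappa> - 1))) \<longlonglongrightarrow> l" if "\<kappa> \<in> {0<..<1}" for \<kappa>
    proof (rule filterlim_compose[OF L_lim])
      have "filterlim (\<lambda>n. inverse ((\<tau> n)\<^sup>2)) at_top sequentially"
        using \<tau> tendsto_power[OF \<tau>_lim, of 2]
        by (intro filterlim_inverse_at_top) (auto simp: less_imp_neq[THEN not_sym])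
      then show "filterlim (\<lambda>n. 1 / (\<tau> n)\<^sup>2 * (1 / \<kappa> - 1)) at_top sequentially"
        using that by (intro filterlim_at_top_mult_tendsto_pos[OF tendsto_const])
          (auto simp: divide_inverse one_less_inverse)
    qed
    have "J b \<longlonglongrightarrow> (\<integral>\<kappa>. indicator {0<..<1} \<kappa> *\<^sub>R (B \<kappa> * l) \<partial>lborel)"
      unfolding J_def set_lebesgue_integral_def
    proof (rule integral_dominated_convergence[where w = "\<lambda>\<kappa>. M * (indicator {0<..<1} \<kappa> *\<^sub>R B \<kappa>)"])
      show "integrable lborel (\<lambda>\<kappa>. M * (indicator {0<..<1} \<kappa> *\<^sub>R B \<kappa>))"
        using intB unfolding set_integrable_def by (intro integrable_mult_right)
      have "(\<lambda>n. indicator {0<..<1} \<kappa> *\<^sub>R kappa_weight b a L (\<tau> n) y \<kappa>)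
          \<longlonglongrightarrow> indicator {0<..<1} \<kappa> *\<^sub>R (B \<kappa> * l)" for \<kappa>
      proof (cases "\<kappa> \<in> {0<..<1}")
        case True
        then show ?thesis
          unfolding kappa_weight_def B_def by (intro tendsto_intros ev)
      qed simp
      then show "AE \<kappa> in lborel. (\<lambda>n. indicator {0<..<1} \<kappa> *\<^sub>R kappa_weight b a L (\<tau> n) y \<kappa>)
          \<longlonglongrightarrow> indicator {0<..<1} \<kappa> *\<^sub>R (B \<kappa> * l)" by simp
      fix n
      show "(\<lambda>\<kappa>. indicator {0<..<1} \<kappa> *\<^sub>R kappa_weight b a L (\<tau> n) y \<kappa>) \<in> borel_measurable lborel"
        using borel_measurable_kappa_weight[OF L \<tau>[of n]] by simp
      have "norm (indicator {0<..<1} \<kappa> *\<^sub>R kappa_weight b a L (\<tau> n) y \<kappa>)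
          \<le> M * (indicator {0<..<1} \<kappa> *\<^sub>R B \<kappa>)" for \<kappa>
      proof (cases "\<kappa> \<in> {0<..<1}")
        case True
        then have "0 < 1 / (\<tau> n)\<^sup>2 * (1 / \<kappa> - 1)" using \<tau>[of n] by simp
        then have "0 \<le> L (1 / (\<tau> n)\<^sup>2 * (1 / \<kappa> - 1))" "L (1 / (\<tau> n)\<^sup>2 * (1 / \<kappa> - 1)) \<le> M"
          using L_nonneg M by blast+
        moreover have "0 \<le> B \<kappa>" by (simp add: B_def)
        ultimately have "\<bar>B \<kappa> * L (1 / (\<tau> n)\<^sup>2 * (1 / \<kappa> - 1))\<bar> \<le> M * B \<kappa>"
          using mult_left_mono[of "L (1 / (\<tau> n)\<^sup>2 * (1 / \<kappa> - 1))" M "B \<kappa>"]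
          by (simp add: abs_mult mult.commute)
        then show ?thesis
          using True by (simp add: kappa_weight_def B_def)
      qed simp
      then show "AE \<kappa> in lborel. norm (indicator {0<..<1} \<kappa> *\<^sub>R kappa_weight b a L (\<tau> n) y \<kappa>)
          \<le> M * (indicator {0<..<1} \<kappa> *\<^sub>R B \<kappa>)" by simp
    qed (simp add: B_def)
    also have "(\<integral>\<kappa>. indicator {0<..<1} \<kappa> *\<^sub>R (B \<kappa> * l) \<partial>lborel) = l * Beta (a + b) (real y - a)"
      unfolding LB[symmetric] set_lebesgue_integral_def
      by (simp add: mult_ac flip: integral_mult_right_zero)
    finally show ?thesis .
  qed
  let ?B = "Beta (a + \<alpha>) (real y - a)"
  have "0 < ?B"
    unfolding Beta_def using a y \<alpha> by (intro divide_pos_pos mult_pos_pos Gamma_real_pos) auto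
  then have "?B \<noteq> 0"
    by simp
  moreover have "a + \<alpha> \<notin> \<int>\<^sub>\<le>\<^sub>0"
    using a \<alpha> by (auto elim!: nonpos_Ints_cases)
  then have "(real y + \<alpha>) * Beta (a + \<alpha> + 1) (real y - a) = (a + \<alpha>) * ?B"
    using Beta_plus1_left[of "a + \<alpha>" "real y - a"] by (simp add: add_ac)
  ultimately have "l * Beta (a + (\<alpha> + 1)) (real y - a) / (l * ?B) = (a + \<alpha>) / (real y + \<alpha>)"
    using l a \<alpha> y by (simp add: field_simps add_ac)
  moreover have "(\<lambda>n. J (\<alpha> + 1) n / J \<alpha> n) \<longlonglongrightarrow>
      l * Beta (a + (\<alpha> + 1)) (real y - a) / (l * ?B)"
    using \<alpha> l \<open>?B \<noteq> 0\<close> by (intro tendsto_divide J) auto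
  ultimately show ?thesis
    by (simp add: kappa_post_mean_eq_ratio J_def)
qed

section \<open>Comparison of the two risks\<close>

lemma pmf_nb_pmf_0:
  assumes "0 < k" "0 < q" "q \<le> 1"
  shows "pmf (nb_pmf k q) 0 = q powr k"
  using assms by (simp add: pmf_nb_pmf nb_mass_def)

lemma pmf_nb_pmf_tendsto:
  assumes k: "0 < k" and q: "\<And>n. 0 < q n \<and> q n \<le> 1" and q_lim: "q \<longlonglongrightarrow> r"
    and r: "0 < r" "r \<le> 1"
  shows "(\<lambda>n. pmf (nb_pmf k (q n)) y) \<longlonglongrightarrow> pmf (nb_pmf k r) y"
proof -
  have "(\<lambda>n. nb_mass k (q n) y) \<longlonglongrightarrow> nb_mass k r y"
    unfolding nb_mass_def using r by (intro tendsto_intros q_lim) auto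
  then show ?thesis
    using k q r by (simp add: pmf_nb_pmf)
qed

text \<open>This bounds the type I error of every rule that accepts at \<open>0\<close>.\<close>

lemma prob_nb_pmf_le:
  assumes k: "0 < k" and s: "0 < s" and A: "0 \<notin> A"
  shows "measure_pmf.prob (nb_pmf k (1 / (s + 1))) A \<le> k * s"
proof -
  let ?P = "nb_pmf k (1 / (s + 1))"
  have "measure_pmf.prob ?P A \<le> measure_pmf.prob ?P (- {0})"
    using A by (intro measure_pmf.finite_measure_mono) auto
  also have "\<dots> = 1 - pmf ?P 0"
    by (subst measure_pmf.prob_compl[of "{0}", simplified, folded Compl_eq_Diff_UNIV])
      (simp_all add: measure_pmf_single)
  also have "\<dots> = 1 - exp (- (k * ln (1 + s)))"
    using k s by (simp add: pmf_nb_pmf_0 powr_def ln_div add.commute)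
  also have "\<dots> \<le> k * ln (1 + s)"
    using exp_ge_add_one_self[of "- (k * ln (1 + s))"] by simp
  also have "\<dots> \<le> k * s"
    using k s ln_add_one_self_le_self[of s] by (intro mult_left_mono) auto
  finally show ?thesis .
qed

text \<open>
  At \<open>0\<close> the likelihood ratio is at most \<open>1\<close>, and \<open>1 \<le> (1 - p) / p\<close> for
  \<open>p \<le> 1/2\<close>. So the oracle accepts at \<open>0\<close> and incurs the type II error of that
  observation; this part of its risk suffices as a lower bound.
\<close>

lemma bayes_oracle_risk_ge:
  assumes pos: "0 < \<alpha>" "0 < \<beta>" "0 < \<delta>" and p: "0 < p" "p \<le> 1 / 2"
  shows "real n * (p * (1 / (\<beta> + \<delta> + 1)) powr \<alpha>) \<le>
    bayes_risk n p \<alpha> \<beta> \<delta> (bayes_oracle p \<alpha> \<beta> \<delta>)"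
proof -
  define D where "D y \<longleftrightarrow>
    marginal_mass p \<alpha> \<beta> \<delta> True y / marginal_mass p \<alpha> \<beta> \<delta> False y > (1 - p) / p" for y
  let ?f1 = "nb_pmf \<alpha> (1 / (\<beta> + \<delta> + 1))"
  have D: "bayes_oracle p \<alpha> \<beta> \<delta> = (\<lambda>i y. D (y i))"
    by (simp add: fun_eq_iff bayes_oracle_def D_def)
  have "marginal_mass p \<alpha> \<beta> \<delta> True 0 / marginal_mass p \<alpha> \<beta> \<delta> False 0 =
      ((\<beta> + 1) / (\<beta> + \<delta> + 1)) powr \<alpha>"
    using pos p by (simp add: marginal_mass_eq_pmf_nb pmf_nb_pmf_0 powr_divide)
  also have "\<dots> \<le> 1 powr \<alpha>"
    using pos by (intro powr_mono2) auto
  also have "1 powr \<alpha> \<le> (1 - p) / p"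
    using p by (simp add: field_simps)
  finally have "\<not> D 0"
    by (simp add: D_def)
  then have "measure_pmf.prob ?f1 {0} \<le> measure_pmf.prob ?f1 {y. \<not> D y}"
    by (intro measure_pmf.finite_measure_mono) auto
  then have "(1 / (\<beta> + \<delta> + 1)) powr \<alpha> \<le> measure_pmf.prob ?f1 {y. \<not> D y}"
    using pos by (simp add: measure_pmf_single pmf_nb_pmf_0)
  then have "p * (1 / (\<beta> + \<delta> + 1)) powr \<alpha> \<le>
      (1 - p) * measure_pmf.prob (nb_pmf \<alpha> (1 / (\<beta> + 1))) {y. D y} + p * measure_pmf.prob ?f1 {y. \<not> D y}"
    using p by (intro add_increasing mult_left_mono) auto
  then show ?thesis
    unfolding D using pos p by (subst bayes_risk_coordinatewise) (auto intro: mult_left_mono)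
qed


theorem theorem1:
  fixes \<alpha> \<delta> a K C1 c :: real
    and L :: "real \<Rightarrow> real"
    and p \<beta> \<tau> :: "nat \<Rightarrow> real"
  assumes "0 < \<alpha>" and "0 < \<delta>"
    and p_range: "\<And>n. 0 < p n \<and> p n < 1"
    and p_lim: "p \<longlonglongrightarrow> 0"
    and C1: "1 < C1"
    and c: "0 < c"
    and beta: "\<And>n. \<beta> n = c * p n powr C1"
    and tau_pos: "\<And>n. 0 < \<tau> n"
    and tau_lim: "\<tau> \<longlonglongrightarrow> 0"
    and a: "1 < a"
    and L_pos: "\<And>x. 0 < x \<Longrightarrow> 0 < L x"
    and L_meas: "L \<in> borel_measurable (restrict_space borel {0<..})"
    and L_nonconst: "\<not> (\<exists>b. \<forall>x>0. L x = b)"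
    and L_sv: "slowly_varying L"
    and K: "0 < K"
    and L_prior: "(\<integral>\<^sup>+u. ennreal (mixing_density K a L u) \<partial>lborel) = 1"
    and A1_lower: "\<exists>c0>0. \<exists>t0>0. \<forall>t\<ge>t0. c0 \<le> L t"
    and A1_lim: "\<exists>l>0. (L \<longlongrightarrow> l) at_top"
    and A2: "\<exists>M>0. \<forall>t>0. L t \<le> M"
  shows
    "let R_OG = (\<lambda>n. bayes_risk n (p n) \<alpha> (\<beta> n) \<delta> (one_group_rule \<alpha> \<delta> a L (\<tau> n)));
         R_opt = (\<lambda>n. bayes_risk n (p n) \<alpha> (\<beta> n) \<delta> (bayes_oracle (p n) \<alpha> (\<beta> n) \<delta>))
     in 1 \<le> liminf (\<lambda>n. ereal (R_OG n / R_opt n)) \<and>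
        liminf (\<lambda>n. ereal (R_OG n / R_opt n)) \<le> limsup (\<lambda>n. ereal (R_OG n / R_opt n)) \<and>
        limsup (\<lambda>n. ereal (R_OG n / R_opt n)) \<le>
          ereal ((\<delta> + 1) powr \<alpha> *
            measure_pmf.prob (nb_pmf \<alpha> (1 / (\<delta> + 1)))
              {y. real y \<le> 2 * a + \<alpha> - 2 * (a + \<alpha>) / (\<delta> + 2)})"
proof -
  obtain l where l: "0 < l" "(L \<longlongrightarrow> l) at_top" using A1_lim by blast
  obtain M where M: "\<And>t. 0 < t \<Longrightarrow> L t \<le> M" using A2 by blast
  define T where "T = 2 * a + \<alpha> - 2 * (a + \<alpha>) / (\<delta> + 2)"
  define D where "D n y \<longleftrightarrow> 1 - kappa_post_mean \<alpha> a L (\<tau> n) y > \<delta> / (2 * (\<delta> + 1))" for n y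
  define f0 where "f0 n = nb_pmf \<alpha> (1 / (\<beta> n + 1))" for n
  define f1 where "f1 n = nb_pmf \<alpha> (1 / (\<beta> n + \<delta> + 1))" for n
  define f where "f = nb_pmf \<alpha> (1 / (\<delta> + 1))"
  define R_OG where "R_OG n = bayes_risk n (p n) \<alpha> (\<beta> n) \<delta> (one_group_rule \<alpha> \<delta> a L (\<tau> n))" for n
  define R_opt where
    "R_opt n = bayes_risk n (p n) \<alpha> (\<beta> n) \<delta> (bayes_oracle (p n) \<alpha> (\<beta> n) \<delta>)" for n
  have p: "0 < p n" "p n < 1" for n using p_range[of n] by auto
  have \<beta>_pos: "0 < \<beta> n" for n using p[of n] c by (simp add: beta)
  have \<beta>_lim: "\<beta> \<longlonglongrightarrow> 0"
  proof -
    have "(\<lambda>n. c * p n powr C1) \<longlonglongrightarrow> c * 0"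
      using p C1 by (intro tendsto_mult tendsto_const tendsto_zero_powrI[OF p_lim tendsto_const])
        (auto intro: always_eventually less_imp_le)
    moreover have "\<beta> = (\<lambda>n. c * p n powr C1)" by (simp add: fun_eq_iff beta)
    ultimately show ?thesis by simp
  qed

  have accepts: "\<forall>\<^sub>F n in sequentially. \<not> D n 0"
  proof -
    have "(\<lambda>n. kappa_post_mean \<alpha> a L (\<tau> n) 0) \<longlonglongrightarrow> 1"
      using assms(1) by (intro kappa_post_mean_0_tendsto[OF L_meas L_pos L_prior K _ tau_pos tau_lim]) auto
    moreover have "1 - \<delta> / (2 * (\<delta> + 1)) < 1" using \<open>0 < \<delta>\<close> by simp
    ultimately have "\<forall>\<^sub>F n in sequentially. 1 - \<delta> / (2 * (\<delta> + 1)) < kappa_post_mean \<alpha> a L (\<tau> n) 0"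
      by (rule order_tendstoD(1))
    then show ?thesis by eventually_elim (simp add: D_def)
  qed
  have rejects: "\<forall>\<^sub>F n in sequentially. D n y" if y: "T < real y" for y
  proof -
    \<comment> \<open>The inequality \<open>\<delta> / (2 (\<delta> + 1)) < (y - a) / (y + \<alpha>)\<close> with denominators cleared;
      it forces \<open>y > a\<close>, which the limit of the posterior mean requires.\<close>
    have *: "\<delta> * (real y + \<alpha>) < 2 * (\<delta> + 1) * (real y - a)"
    proof -
      have "T * (\<delta> + 2) = 2 * a * (\<delta> + 1) + \<alpha> * \<delta>"
        using \<open>0 < \<delta>\<close> by (simp add: T_def field_simps)
      moreover have "T * (\<delta> + 2) < real y * (\<delta> + 2)"
        using y \<open>0 < \<delta>\<close> by (intro mult_strict_right_mono) auto
      ultimately show ?thesis by (simp add: algebra_simps)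
    qed
    have "0 < 2 * (\<delta> + 1) * (real y - a)"
      using * \<open>0 < \<delta>\<close> \<open>0 < \<alpha>\<close> by (rule_tac le_less_trans[OF _ *]) simp
    then have ya: "a < real y"
      using \<open>0 < \<delta>\<close> by (simp add: zero_less_mult_iff)
    have "(\<lambda>n. kappa_post_mean \<alpha> a L (\<tau> n) y) \<longlonglongrightarrow> (a + \<alpha>) / (real y + \<alpha>)"
      using \<open>0 < \<alpha>\<close> l a ya L_pos
      by (intro kappa_post_mean_tendsto[OF L_meas _ M l(2) _ _ _ _ tau_pos tau_lim]) (auto intro: less_imp_le)
    moreover have "(a + \<alpha>) / (real y + \<alpha>) < 1 - \<delta> / (2 * (\<delta> + 1))"
    proof -
      have "1 - (a + \<alpha>) / (real y + \<alpha>) = (real y - a) / (real y + \<alpha>)"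
        using \<open>0 < \<alpha>\<close> by (simp add: field_simps)
      moreover have "\<delta> / (2 * (\<delta> + 1)) < (real y - a) / (real y + \<alpha>)"
        using * \<open>0 < \<alpha>\<close> \<open>0 < \<delta>\<close> by (simp add: divide_less_eq less_divide_eq mult_ac add_pos_pos add_nonneg_pos)
      ultimately show ?thesis by linarith
    qed
    ultimately have "\<forall>\<^sub>F n in sequentially. kappa_post_mean \<alpha> a L (\<tau> n) y < 1 - \<delta> / (2 * (\<delta> + 1))"
      by (rule order_tendstoD(2))
    then show ?thesis by eventually_elim (simp add: D_def)
  qed

  have p_small: "\<forall>\<^sub>F n in sequentially. p n < 1 / 2"
    using order_tendstoD(2)[OF p_lim, of "1 / 2"] by simp
  have opt_ge: "\<forall>\<^sub>F n in sequentially.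
      0 < real n * (p n * (1 / (\<beta> n + \<delta> + 1)) powr \<alpha>) \<and>
      real n * (p n * (1 / (\<beta> n + \<delta> + 1)) powr \<alpha>) \<le> R_opt n"
    using p_small eventually_gt_at_top[of 0]
  proof eventually_elim
    case (elim n)
    have "0 < 1 / (\<beta> n + \<delta> + 1)" using \<beta>_pos[of n] \<open>0 < \<delta>\<close> by simp
    then have "0 < (1 / (\<beta> n + \<delta> + 1)) powr \<alpha>" by simp
    then show ?case
      using bayes_oracle_risk_ge[OF \<open>0 < \<alpha>\<close> \<beta>_pos[of n] \<open>0 < \<delta>\<close> p(1)[of n], of n] elim p(1)[of n]
      by (simp add: R_opt_def)
  qed

  have lower: "1 \<le> liminf (\<lambda>n. ereal (R_OG n / R_opt n))"
  proof (rule Liminf_bounded)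
    show "\<forall>\<^sub>F n in sequentially. 1 \<le> ereal (R_OG n / R_opt n)"
      using opt_ge
    proof eventually_elim
      case (elim n)
      have "R_opt n \<le> R_OG n"
        unfolding R_opt_def R_OG_def
        by (rule bayes_oracle_optimal[OF \<open>0 < \<alpha>\<close> \<beta>_pos \<open>0 < \<delta>\<close> p])
      with elim show ?case by simp
    qed
  qed

  have upper: "limsup (\<lambda>n. ereal (R_OG n / R_opt n)) \<le>
      ereal ((\<delta> + 1) powr \<alpha> * (1 - measure_pmf.prob f {y. y \<le> N \<and> T < real y}))" for N :: nat
  proof -
    let ?S = "{y. y \<le> N \<and> T < real y}"
    have fin: "finite ?S" by (rule finite_subset[of _ "{..N}"]) auto
    \<comment> \<open>The type I part, divided by \<open>p\<close>, is at most \<open>\<alpha> \<beta> / p = \<alpha> c p\<^bsup>C1-1\<^esup>\<close>; the type II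
      part is at most the probability of the complement of \<open>?S\<close>, all of which is rejected.\<close>
    define u where "u n = (\<beta> n + \<delta> + 1) powr \<alpha> *
      (\<alpha> * c * p n powr (C1 - 1) + (1 - (\<Sum>y\<in>?S. pmf (f1 n) y)))" for n
    have "\<forall>\<^sub>F n in sequentially. \<forall>y\<in>?S. D n y"
      using rejects by (intro eventually_ball_finite fin) auto
    then have "\<forall>\<^sub>F n in sequentially. ereal (R_OG n / R_opt n) \<le> ereal (u n)"
      using accepts opt_ge
    proof eventually_elim
      case (elim n)
      let ?q = "(1 / (\<beta> n + \<delta> + 1)) powr \<alpha>"
      have OG: "R_OG n = real n * ((1 - p n) * measure_pmf.prob (f0 n) {y. D n y} +
          p n * measure_pmf.prob (f1 n) {y. \<not> D n y})"
        unfolding R_OG_def f0_def f1_def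
        by (subst bayes_risk_coordinatewise[OF \<open>0 < \<alpha>\<close> \<beta>_pos \<open>0 < \<delta>\<close> p, symmetric])
          (simp add: one_group_rule_def[abs_def] D_def)
      have t1: "(1 - p n) * measure_pmf.prob (f0 n) {y. D n y} \<le> p n * (\<alpha> * c * p n powr (C1 - 1))"
      proof -
        have "(1 - p n) * measure_pmf.prob (f0 n) {y. D n y} \<le> 1 * measure_pmf.prob (f0 n) {y. D n y}"
          using p[of n] by (intro mult_right_mono) auto
        also have "\<dots> \<le> \<alpha> * \<beta> n"
          unfolding f0_def mult_1
          by (rule prob_nb_pmf_le[OF \<open>0 < \<alpha>\<close> \<beta>_pos]) (use elim in simp)
        also have "\<dots> = p n * (\<alpha> * c * p n powr (C1 - 1))"
          using p[of n] by (simp add: beta powr_diff)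
        finally show ?thesis .
      qed
      have "measure_pmf.prob (f1 n) {y. \<not> D n y} \<le> measure_pmf.prob (f1 n) (- ?S)"
        using elim by (intro measure_pmf.finite_measure_mono) auto
      also have "\<dots> = 1 - (\<Sum>y\<in>?S. pmf (f1 n) y)"
        using measure_pmf.prob_compl[of ?S "f1 n"] fin
        by (simp add: measure_measure_pmf_finite Compl_eq_Diff_UNIV)
      finally have t2: "measure_pmf.prob (f1 n) {y. \<not> D n y} \<le> \<dots>" .
      have "R_OG n \<le> real n * (p n * (\<alpha> * c * p n powr (C1 - 1)) + p n * (1 - (\<Sum>y\<in>?S. pmf (f1 n) y)))"
        unfolding OG using t1 t2 p[of n] by (intro mult_left_mono add_mono) auto
      also have "\<dots> = u n * (real n * (p n * ?q))"
        using \<beta>_pos[of n] \<open>0 < \<delta>\<close> by (simp add: u_def powr_divide field_simps)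
      finally have num: "R_OG n \<le> u n * (real n * (p n * ?q))" .
      have "0 \<le> u n"
        using p[of n] \<open>0 < \<alpha>\<close> c t2 order_trans[OF measure_nonneg t2] by (simp add: u_def)
      then have "R_OG n \<le> u n * R_opt n"
        using num elim mult_left_mono[of "real n * (p n * ?q)" "R_opt n" "u n"] by linarith
      moreover have "0 < R_opt n" using elim by linarith
      ultimately show ?case by (simp add: divide_le_eq)
    qed
    then have "limsup (\<lambda>n. ereal (R_OG n / R_opt n)) \<le> limsup (\<lambda>n. ereal (u n))"
      by (rule Limsup_mono)
    also have "\<dots> = ereal ((\<delta> + 1) powr \<alpha> * (1 - measure_pmf.prob f ?S))"
    proof (rule lim_imp_Limsup)
      have pw: "(\<lambda>n. p n powr (C1 - 1)) \<longlonglongrightarrow> 0"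
        using p C1 by (intro tendsto_zero_powrI[OF p_lim tendsto_const])
          (auto intro: always_eventually less_imp_le)
      have "(\<lambda>n. 1 / (\<beta> n + \<delta> + 1)) \<longlonglongrightarrow> 1 / (0 + \<delta> + 1)"
        using \<open>0 < \<delta>\<close> by (intro tendsto_intros \<beta>_lim) auto
      then have pmf: "(\<lambda>n. pmf (f1 n) y) \<longlonglongrightarrow> pmf f y" for y
        unfolding f1_def f_def using \<beta>_pos \<open>0 < \<delta>\<close> \<open>0 < \<alpha>\<close>
        by (intro pmf_nb_pmf_tendsto) (auto simp: divide_le_eq add_nonneg_pos less_imp_le add_pos_pos)
      have "u \<longlonglongrightarrow> (0 + \<delta> + 1) powr \<alpha> * (\<alpha> * c * 0 + (1 - (\<Sum>y\<in>?S. pmf f y)))"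
        unfolding u_def using \<open>0 < \<delta>\<close> by (intro tendsto_intros \<beta>_lim pw pmf) auto
      then show "(\<lambda>n. ereal (u n)) \<longlonglongrightarrow> ereal ((\<delta> + 1) powr \<alpha> * (1 - measure_pmf.prob f ?S))"
        using fin by (simp add: measure_measure_pmf_finite)
    qed simp
    finally show ?thesis .
  qed
  have "(\<lambda>N. measure_pmf.prob f {y. y \<le> N \<and> T < real y}) \<longlonglongrightarrow>
      measure_pmf.prob f (\<Union>N. {y. y \<le> N \<and> T < real y})"
    by (intro measure_pmf.finite_Lim_measure_incseq) (auto simp: incseq_def)
  moreover have "(\<Union>N. {y. y \<le> N \<and> T < real y}) = UNIV - {y. real y \<le> T}"
    by auto
  ultimately have "(\<lambda>N. measure_pmf.prob f {y. y \<le> N \<and> T < real y}) \<longlonglongrightarrow>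
      1 - measure_pmf.prob f {y. real y \<le> T}"
    using measure_pmf.prob_compl[of "{y. real y \<le> T}" f] by simp
  then have "(\<lambda>N. (\<delta> + 1) powr \<alpha> * (1 - measure_pmf.prob f {y. y \<le> N \<and> T < real y})) \<longlonglongrightarrow>
      (\<delta> + 1) powr \<alpha> * (1 - (1 - measure_pmf.prob f {y. real y \<le> T}))"
    by (intro tendsto_intros)
  then have "limsup (\<lambda>n. ereal (R_OG n / R_opt n)) \<le>
      ereal ((\<delta> + 1) powr \<alpha> * (1 - (1 - measure_pmf.prob f {y. real y \<le> T})))"
    using upper by (intro LIMSEQ_le_const[OF tendsto_ereal]) auto
  moreover have "liminf (\<lambda>n. ereal (R_OG n / R_opt n)) \<le> limsup (\<lambda>n. ereal (R_OG n / R_opt n))"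
    by (rule Liminf_le_Limsup) simp
  ultimately show ?thesis
    using lower by (simp add: Let_def R_OG_def R_opt_def f_def T_def)
qed

end
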